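(* Let $m\ge 2$, $q=3^m$, $\mathbb{F}=\mathbb{F}_q$, and $a\in\mathbb{F}^*$. Let $u_1\in\mathbb{F}$ be such that $u_1^3+u_1^2-a$ is a square in $\mathbb{F}$ (i.e. there is $y\in\mathbb{F}$ with $(u_1,y)\in E(a)$) and $$\mathrm{Tr}\!\left(\frac{a\sqrt{u_1^3+u_1^2-a}}{u_1^3}\right)\neq 0$$ (this condition does not depend on the choice of square root). Define $u_2,u_3,\dots$ recursively by $$u_{i+1}=\frac{(u_i^3-a)^3+a\,u_i^3}{(u_i^3-a)^2},\qquad i=1,2,\dots,$$ the recursion being continued as long as $u_i\neq a^{1/3}$. Then there exists an integer $k\le m$ such that one of the following holds: (i) $u_k=a^{1/3}$ and $u_i\neq a^{1/3}$ for all $i<k$; or (ii) $u_{k+1}=u_{k+1+r}$ for some integer $r\ge 1$, and the elements $u_i$, $1\le i<k+1+r$, are pairwise distinct. In either case $3^k$ divides $K(a)$ and $3^{k+1}$ does not divide $K(a)$ (with the convention below when $K(a)=0$).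
   Context: $\mathbb{F}=\mathbb{F}_{3^m}$ and $\mathrm{Tr}(x)=x+x^3+\dots+x^{3^{m-1}}$ is the absolute trace to $\mathbb{F}_3$. For $x\in\mathbb{F}$ and $i\ge1$, $x^{-i}$ means $x^{q-1-i}$, and $b/x=b\,x^{-1}$. $a^{1/3}$ denotes the unique cube root of $a$ in $\mathbb{F}$. With $\omega=e^{2\pi i/3}$, $K(a)=\sum_{x\in\mathbb{F}}\omega^{\mathrm{Tr}(x+a/x)}$. $E(a)=\{(x,y)\in\mathbb{F}\times\mathbb{F}: y^2=x^3+x^2-a\}$. Convention: if $K(a)=0$, one says that $3^m$ divides $K(a)$ but $3^{m+1}$ does not. *)

theory Defs
  imports Complex_Main
begin

definition Tr :: "nat \<Rightarrow> 'a::field \<Rightarrow> 'a" where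
  "Tr m x = (\<Sum>i<m. x ^ (3 ^ i))"

definition F3val :: "'a::field \<Rightarrow> nat" where
  "F3val t = (THE j. j < 3 \<and> t = of_nat j)"

text \<open>Kloosterman-type sum K(a) = sum over x in F of omega^(Tr(x + a/x)),
  omega = exp(2 pi i/3); a/x = a * x^(q-2), which agrees with Isabelle's a/0 = 0.\<close>
definition K :: "nat \<Rightarrow> 'a::{finite,field} \<Rightarrow> complex" where
  "K m a = (\<Sum>x\<in>(UNIV::'a set). cis (2 * pi * real (F3val (Tr m (x + a / x))) / 3))"

definition E :: "'a::field \<Rightarrow> ('a \<times> 'a) set" where
  "E a = {(x, y). y ^ 2 = x ^ 3 + x ^ 2 - a}"

text \<open>The unique cube root (Frobenius is bijective in characteristic 3).\<close>
definition cbrt :: "'a::field \<Rightarrow> 'a" where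
  "cbrt a = (THE c. c ^ 3 = a)"

text \<open>Exact 3-adic divisibility with the convention: if K(a) = 0 then 3^m divides K(a)
  and 3^(m+1) does not.  K(a) is a rational integer.\<close>
definition exact_3_power :: "nat \<Rightarrow> nat \<Rightarrow> complex \<Rightarrow> bool" where
  "exact_3_power m k z = (if z = 0 then k = m
     else (\<exists>n::int. z = of_int n \<and> (3::int) ^ k dvd n \<and> \<not> (3::int) ^ (k + 1) dvd n))"

end

theory Submission
  imports Defs "HOL-Computational_Algebra.Polynomial"
begin

text \<open>
  Let \<open>S\<close> be the set of points of the projective closure of \<open>y\<^sup>2 = x\<^sup>3 + x\<^sup>2 - a\<close>. The recursion is the effect
  on first coordinates of multiplication by 3, which is the Frobenius map followed by an explicit
  3-isogeny. Associativity of the group law is not needed: it suffices that the operation sending two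
  points to the third point on their line is a commutative operation with \<open>P * (P * Q) = Q\<close>, and that
  tripling is an endomorphism for it whose kernel \<open>{0, t, -t}\<close> consists of the flexes. Then the
  image of tripling is a third of \<open>S\<close>, and one iterates until \<open>t\<close> leaves the image; rotating the
  collinear triples shows that the cardinality of the remaining set is prime to 3. So the number
  \<open>k\<close> of steps is the exact power of 3 dividing the cardinality of \<open>S\<close>, and every point outside the
  image of tripling needs exactly \<open>k\<close> steps to reach the set on which tripling is a permutation. The
  trace condition expresses that the starting point is outside the image, since the 3-isogeny is the
  Artin-Schreier cover \<open>z - z\<^sup>3 = a y / x\<^sup>3\<close>. Finally \<open>|S| = q + K(a)\<close> by a character sum computation,
  and \<open>|K(a)| < q\<close>.
\<close>

subsection \<open>Endomorphisms of totally symmetric quasigroups\<close>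

text \<open>In the group law with origin \<open>e\<close>, \<open>star P Q\<close> stands for -(P +
  Q), \<open>star e P\<close> for -P, \<open>T\<close> for multiplication by 3 and \<open>t\<close>
  for a point of order 3. \<open>star_self\<close> says that the flexes form the kernel of
  \<open>T\<close>.\<close>

locale star_system =
  fixes S :: "'p set" and e :: 'p and star :: "'p \<Rightarrow> 'p \<Rightarrow> 'p" and T :: "'p \<Rightarrow> 'p" and t :: 'p
  assumes finite_S: "finite S"
    and e_in: "e \<in> S"
    and star_in: "P \<in> S \<Longrightarrow> Q \<in> S \<Longrightarrow> star P Q \<in> S"
    and star_commute: "P \<in> S \<Longrightarrow> Q \<in> S \<Longrightarrow> star P Q = star Q P"
    and star_star: "P \<in> S \<Longrightarrow> Q \<in> S \<Longrightarrow> star P (star P Q) = Q"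
    and star_e: "star e e = e"
    and T_in: "P \<in> S \<Longrightarrow> T P \<in> S"
    and T_star: "P \<in> S \<Longrightarrow> Q \<in> S \<Longrightarrow> T (star P Q) = star (T P) (T Q)"
    and T_e: "T e = e"
    and t_in: "t \<in> S"
    and t_distinct: "t \<noteq> e" "star e t \<noteq> t"
    and T_eq_e: "P \<in> S \<Longrightarrow> T P = e \<longleftrightarrow> P = e \<or> P = t \<or> P = star e t"
    and star_self: "P \<in> S \<Longrightarrow> star P P = P \<longleftrightarrow> T P = e"
begin

abbreviation neg :: "'p \<Rightarrow> 'p" where "neg \<equiv> star e"

text \<open>In the group reading this is Q - P. It turns equal values of a power of \<open>T\<close>
  into kernel elements, and \<open>star_neg_diff\<close> recovers \<open>P\<close> from it and
  \<open>Q\<close>.\<close>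

definition diff :: "'p \<Rightarrow> 'p \<Rightarrow> 'p" where "diff P Q = star P (neg Q)"

text \<open>Plays the role of a subgroup; negatives are included because \<open>neg\<close> is
  \<open>star e\<close>.\<close>

definition closed :: "'p set \<Rightarrow> bool" where
  "closed H \<longleftrightarrow> H \<subseteq> S \<and> e \<in> H \<and> (\<forall>P\<in>H. \<forall>Q\<in>H. star P Q \<in> H)"

lemma closedD:
  assumes "closed H"
  shows "P \<in> H \<Longrightarrow> P \<in> S" "e \<in> H" "P \<in> H \<Longrightarrow> Q \<in> H \<Longrightarrow> star P Q \<in> H"
    "P \<in> H \<Longrightarrow> neg P \<in> H" "P \<in> H \<Longrightarrow> Q \<in> H \<Longrightarrow> diff P Q \<in> H" "finite H"
  using assms finite_S finite_subset unfolding closed_def diff_def by blast+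

lemma closed_S: "closed S"
  by (simp add: closed_def e_in star_in)

lemma neg_in: "P \<in> S \<Longrightarrow> neg P \<in> S"
  and diff_in: "P \<in> S \<Longrightarrow> Q \<in> S \<Longrightarrow> diff P Q \<in> S"
  using closedD[OF closed_S] by blast+

lemma neg_neg: "P \<in> S \<Longrightarrow> neg (neg P) = P"
  by (simp add: e_in star_star)

lemma diff_eq_e: "P \<in> S \<Longrightarrow> Q \<in> S \<Longrightarrow> diff P Q = e \<longleftrightarrow> P = Q"
  unfolding diff_def
  by (metis e_in neg_in neg_neg star_commute star_star)

lemma star_neg_diff: "P \<in> S \<Longrightarrow> Q \<in> S \<Longrightarrow> star (neg Q) (diff P Q) = P"
  unfolding diff_def by (metis neg_in star_commute star_star)

lemma Tn_in: "P \<in> S \<Longrightarrow> (T ^^ n) P \<in> S"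
  by (induction n) (auto intro: T_in)

lemma Tn_star: "P \<in> S \<Longrightarrow> Q \<in> S \<Longrightarrow> (T ^^ n) (star P Q) = star ((T ^^ n) P) ((T ^^ n) Q)"
  by (induction n) (auto simp: T_star Tn_in)

lemma Tn_e: "(T ^^ n) e = e"
  by (induction n) (auto simp: T_e)

lemma Tn_neg: "P \<in> S \<Longrightarrow> (T ^^ n) (neg P) = neg ((T ^^ n) P)"
  using Tn_star[OF e_in] by (simp add: Tn_e)

lemma Tn_diff: "P \<in> S \<Longrightarrow> Q \<in> S \<Longrightarrow> (T ^^ n) (diff P Q) = diff ((T ^^ n) P) ((T ^^ n) Q)"
  by (simp add: diff_def Tn_star Tn_neg neg_in)

lemma T_eq_iff: "P \<in> S \<Longrightarrow> Q \<in> S \<Longrightarrow> T P = T Q \<longleftrightarrow> T (diff P Q) = e"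
  using Tn_diff[of P Q 1] diff_eq_e[of "T P" "T Q"] by (simp add: T_in)

lemma closed_image:
  assumes "closed H" shows "closed (T ` H)"
proof -
  have "star (T P) (T Q) \<in> T ` H" if "P \<in> H" "Q \<in> H" for P Q
    using that closedD[OF assms] T_star[of P Q] by (metis image_eqI)
  moreover have "e \<in> T ` H" using closedD(2)[OF assms] T_e by force
  ultimately show ?thesis using closedD[OF assms] T_in by (auto simp: closed_def)
qed

definition lvl :: "nat \<Rightarrow> 'p set" where "lvl j = (T ^^ j) ` S"

lemma lvl_0 [simp]: "lvl 0 = S" by (simp add: lvl_def)

lemma lvl_Suc: "lvl (Suc j) = T ` lvl j" by (simp add: lvl_def image_image)

lemma lvl_add: "lvl (i + j) = (T ^^ i) ` lvl j"
  by (simp add: lvl_def funpow_add image_comp)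

lemma closed_lvl: "closed (lvl j)"
  by (induction j) (auto simp: lvl_Suc closed_S closed_image)

lemma lvl_antimono: "i \<le> j \<Longrightarrow> lvl j \<subseteq> lvl i"
proof (induction rule: dec_induct)
  case (step n)
  have "lvl (Suc n) \<subseteq> lvl n" for n
  proof (induction n)
    case 0 then show ?case using T_in by (auto simp: lvl_Suc)
  next
    case (Suc n) then show ?case by (metis image_mono lvl_Suc)
  qed
  then show ?case using step by blast
qed auto

text \<open>The kernel meets \<open>H\<close> only in \<open>e\<close>: if \<open>neg t\<close> were
  in \<open>H\<close>, so would be \<open>t = neg (neg t)\<close>.\<close>

lemma inj_on_T:
  assumes H: "closed H" and "t \<notin> H" shows "inj_on T H"
proof (rule inj_onI)
  fix P Q assume P: "P \<in> H" and Q: "Q \<in> H" and eq: "T P = T Q"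
  have S: "P \<in> S" "Q \<in> S" and D: "diff P Q \<in> H" "neg (diff P Q) \<in> H"
    using closedD[OF H] P Q by auto
  have "T (diff P Q) = e" using eq S T_eq_iff by blast
  then have "diff P Q = e"
    using T_eq_e diff_in S D \<open>t \<notin> H\<close> neg_neg t_in by metis
  then show "P = Q" using diff_eq_e S by blast
qed

text \<open>The fibre through \<open>Q\<close> is a coset of the kernel, obtained without
  associativity as the image of \<open>{e, t, neg t}\<close> under \<open>star (neg Q)\<close>. It
  stays inside \<open>H\<close> because \<open>t\<close> and \<open>Q\<close> do.\<close>

lemma card_T_image:
  assumes H: "closed H" and t: "t \<in> H" shows "card H = 3 * card (T ` H)"
proof -
  have fiber: "card {P \<in> H. T P = T Q} = 3" if Q: "Q \<in> H" for Q
  proof -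
    have QS: "Q \<in> S" using Q closedD[OF H] by blast
    have "bij_betw (star (neg Q)) {e, t, neg t} {P \<in> H. T P = T Q}"
    proof (rule bij_betw_byWitness[where f' = "\<lambda>P. diff P Q"])
      show "\<forall>R\<in>{e, t, neg t}. diff (star (neg Q) R) Q = R"
      proof
        fix R assume "R \<in> {e, t, neg t}"
        then have "R \<in> S" using t_in e_in neg_in by auto
        then have "diff (star (neg Q) R) Q = star (neg Q) (star (neg Q) R)"
          unfolding diff_def using QS neg_in star_in by (intro star_commute) auto
        then show "diff (star (neg Q) R) Q = R" using star_star QS neg_in \<open>R \<in> S\<close> by simp
      qed
      show "\<forall>P\<in>{P \<in> H. T P = T Q}. star (neg Q) (diff P Q) = P"
        using star_neg_diff QS closedD[OF H] by blast
      show "star (neg Q) ` {e, t, neg t} \<subseteq> {P \<in> H. T P = T Q}"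
      proof (clarify, intro conjI)
        fix R assume R: "R \<in> {e, t, neg t}"
        then have RH: "R \<in> H" "R \<in> S" using t closedD[OF H] by auto
        then show "star (neg Q) R \<in> H" using Q closedD[OF H] by blast
        have "T R = e" using R RH T_eq_e by auto
        then have "T (star (neg Q) R) = star (neg (T Q)) e"
          using RH QS T_star neg_in T_e e_in by metis
        also have "\<dots> = T Q" using QS T_in neg_in neg_neg star_commute e_in by metis
        finally show "T (star (neg Q) R) = T Q" .
      qed
      show "(\<lambda>P. diff P Q) ` {P \<in> H. T P = T Q} \<subseteq> {e, t, neg t}"
        using T_eq_iff T_eq_e diff_in QS closedD[OF H] by blast
    qed
    moreover have "neg t \<noteq> e" using neg_neg[OF t_in] t_distinct star_e by metis
    then have "card {e, t, neg t} = 3" using t_distinct by (auto simp: card_insert_if)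
    ultimately show ?thesis by (metis bij_betw_same_card)
  qed
  have "card H = (\<Sum>y\<in>T ` H. \<Sum>P\<in>{P \<in> H. T P = y}. 1)"
    using sum.group[of H "T ` H" T "\<lambda>_. 1 :: nat"] closedD[OF H] by simp
  also have "\<dots> = (\<Sum>y\<in>T ` H. 3)" using fiber by (intro sum.cong) auto
  finally show ?thesis by simp
qed

end

text \<open>The moved points split into orbits \<open>{x, f x, f (f x)}\<close>, each of size
  exactly 3.\<close>

lemma card_fixed_points_order_3:
  fixes f :: "'b \<Rightarrow> 'b"
  assumes fin: "finite X" and maps: "\<And>x. x \<in> X \<Longrightarrow> f x \<in> X"
    and cube: "\<And>x. x \<in> X \<Longrightarrow> f (f (f x)) = x"
  shows "3 dvd card {x \<in> X. f x \<noteq> x}"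
proof -
  let ?X = "{x \<in> X. f x \<noteq> x}" and ?C = "(\<lambda>x. {x, f x, f (f x)}) ` {x \<in> X. f x \<noteq> x}"
  have "\<Union>?C = ?X" using maps cube by (auto) metis+
  moreover have "3 dvd card (\<Union>?C)"
  proof (rule dvd_partition)
    show "finite (\<Union>?C)" using fin by auto
    show "\<forall>c\<in>?C. 3 dvd card c"
    proof clarify
      fix x assume "x \<in> X" "f x \<noteq> x"
      then have "card {x, f x, f (f x)} = 3"
        using cube[of x] maps cube[of "f x"] by (auto simp: card_insert_if) 
      then show "3 dvd card {x, f x, f (f x)}" by simp
    qed
    have "{x, f x, f (f x)} = {y, f y, f (f y)}"
      if "x \<in> X" "y \<in> X" "z \<in> {x, f x, f (f x)}" "z \<in> {y, f y, f (f y)}" for x y z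
    proof -
      have "{w, f w, f (f w)} = {z, f z, f (f z)}" if "w \<in> X" "z \<in> {w, f w, f (f w)}" for w
        using that cube[of w] by auto
      then show ?thesis using that by blast
    qed
    then show "\<forall>c1\<in>?C. \<forall>c2\<in>?C. c1 \<noteq> c2 \<longrightarrow> c1 \<inter> c2 = {}" by blast
  qed
  ultimately show ?thesis by simp
qed

section \<open>The exact power of 3 and the orbits of \<open>T\<close>\<close>

context star_system begin

text \<open>The rotation \<open>f\<close> of collinear triples \<open>(P, Q, star P Q)\<close> has
  order 3. A fixed pair is \<open>(P, P)\<close> with \<open>P\<close> a flex, so only
  \<open>(e, e)\<close> when \<open>t\<close> is missing; hence the square of \<open>card H\<close>
  is 1 modulo 3.\<close>

lemma not_3_dvd_card:
  assumes H: "closed H" and t: "t \<notin> H" shows "\<not> 3 dvd card H"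
proof -
  define f where "f = (\<lambda>(P, Q). (Q, star P Q))"
  have finX: "finite (H \<times> H)" using closedD[OF H] by auto
  have "3 dvd card {x \<in> H \<times> H. f x \<noteq> x}"
  proof (rule card_fixed_points_order_3[OF finX])
    fix x assume x: "x \<in> H \<times> H"
    obtain P Q where PQ: "x = (P, Q)" "P \<in> H" "Q \<in> H" "P \<in> S" "Q \<in> S"
      using x closedD[OF H] by auto
    show "f x \<in> H \<times> H" using PQ closedD[OF H] by (auto simp: f_def)
    have "star Q (star P Q) = P" using PQ star_commute star_star by metis
    moreover have "star (star P Q) P = Q" using PQ star_commute star_star star_in by metis
    ultimately show "f (f (f x)) = x" using PQ by (simp add: f_def)
  qed
  moreover have "{x \<in> H \<times> H. f x = x} = {(e, e)}"
  proof -
    have "P = e" if "P \<in> H" "star P P = P" for P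
      using that t T_eq_e star_self closedD[OF H] neg_neg t_in by metis
    then have "(P, Q) \<in> H \<times> H \<Longrightarrow> f (P, Q) = (P, Q) \<Longrightarrow> (P, Q) = (e, e)" for P Q
      by (auto simp: f_def)
    moreover have "(e, e) \<in> {x \<in> H \<times> H. f x = x}"
      using closedD(2)[OF H] star_e by (simp add: f_def)
    ultimately show ?thesis by blast
  qed
  moreover have "card (H \<times> H) = card {x \<in> H \<times> H. f x \<noteq> x} + card {x \<in> H \<times> H. f x = x}"
    using finX by (subst card_Un_disjoint[symmetric]) (auto intro: arg_cong[where f = card])
  ultimately have "3 dvd card H * card H - 1" by (simp add: card_cartesian_product)
  moreover have "card H * card H > 0" using closedD[OF H] by (auto simp: card_gt_0_iff)
  ultimately show ?thesis
    using dvd_diffD1[of 3 "card H * card H" 1] by (auto simp: Suc_le_eq)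
qed

text \<open>For \<open>j < depth\<close> the whole kernel of \<open>T\<close> lies in
  \<open>lvl j\<close>, so each of these steps shrinks the image by the factor 3; from
  \<open>depth\<close> on \<open>T\<close> is injective.\<close>

definition depth :: nat where "depth = (LEAST k. t \<notin> lvl k)"

lemma card_lvl: "(\<And>i. i < j \<Longrightarrow> t \<in> lvl i) \<Longrightarrow> card S = 3 ^ j * card (lvl j)"
proof (induction j)
  case (Suc j)
  then show ?case using card_T_image[OF closed_lvl, of j] by (simp add: lvl_Suc)
qed simp

lemma ex_depth: "\<exists>k. t \<notin> lvl k"
proof (rule ccontr)
  assume "\<nexists>k. t \<notin> lvl k"
  then have "card S = 3 ^ card S * card (lvl (card S))" by (intro card_lvl) auto
  moreover have "card S > 0" using finite_S e_in by (auto simp: card_gt_0_iff)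
  moreover have "card S < 3 ^ card S" by (rule less_exp[THEN less_le_trans]) (auto intro: power_mono)
  ultimately show False by (metis dvd_imp_le dvd_triv_left leD)
qed

lemma not_in_lvl_depth: "t \<notin> lvl depth"
  unfolding depth_def using ex_depth by (metis LeastI)

lemma in_lvl_less_depth: "j < depth \<Longrightarrow> t \<in> lvl j"
  unfolding depth_def using not_less_Least by blast

lemma exact_power_card: "3 ^ depth dvd card S" "\<not> 3 ^ (depth + 1) dvd card S"
proof -
  have c: "card S = 3 ^ depth * card (lvl depth)"
    using in_lvl_less_depth by (rule card_lvl)
  then show "3 ^ depth dvd card S" by simp
  show "\<not> 3 ^ (depth + 1) dvd card S"
    using not_3_dvd_card[OF closed_lvl not_in_lvl_depth] by (simp add: c mult.commute)
qed

text \<open>Induction: \<open>(T ^^ j) R\<close> lies in the kernel of \<open>T\<close>, which is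
  still inside \<open>lvl (Suc j)\<close>, so it equals \<open>(T ^^ j) (T s)\<close>. Then
  \<open>R\<close> and \<open>T s\<close> differ by an element killed by \<open>T ^^ j\<close>,
  which is in the image by induction.\<close>

lemma kernel_Tn:
  "j < depth \<Longrightarrow> R \<in> S \<Longrightarrow> (T ^^ j) R = e \<Longrightarrow> R \<in> lvl 1"
proof (induction j arbitrary: R)
  case 0
  then show ?case using closedD(2)[OF closed_lvl] by simp
next
  case (Suc j)
  let ?X = "(T ^^ j) R"
  have XS: "?X \<in> S" using Suc Tn_in by blast
  have "T ?X = e" using Suc.prems by simp
  then have "?X = e \<or> ?X = t \<or> ?X = neg t" using T_eq_e XS by blast
  then have "?X \<in> lvl (Suc j)"
    using in_lvl_less_depth[OF Suc.prems(1)] closedD[OF closed_lvl] by metis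
  then obtain s where s: "s \<in> S" "?X = (T ^^ j) (T s)"
    by (auto simp: lvl_def funpow_swap1)
  then have "(T ^^ j) (diff R (T s)) = e"
    using Suc.prems T_in XS by (simp add: Tn_diff diff_eq_e Tn_in)
  then have "diff R (T s) \<in> lvl 1" using Suc s T_in diff_in by simp
  moreover have "T s \<in> lvl 1" using s by (simp add: lvl_def)
  ultimately have "star (neg (T s)) (diff R (T s)) \<in> lvl 1"
    using closedD[OF closed_lvl] by blast
  then show ?case using star_neg_diff s T_in Suc.prems by simp
qed

text \<open>Otherwise \<open>P\<close> would differ from some \<open>T Q\<close> by an element
  killed by \<open>T ^^ j\<close>. That element is in the image of \<open>T\<close> by
  \<open>kernel_Tn\<close>, and so \<open>P\<close> would be too.\<close>

lemma Tn_not_in_lvl: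
  assumes P: "P \<in> S" "P \<notin> T ` S" and j: "j < depth"
  shows "(T ^^ j) P \<notin> lvl (Suc j)"
proof
  assume "(T ^^ j) P \<in> lvl (Suc j)"
  then obtain Q where Q: "Q \<in> S" "(T ^^ j) P = (T ^^ j) (T Q)"
    by (auto simp: lvl_def funpow_swap1)
  then have "(T ^^ j) (diff P (T Q)) = e"
    using P T_in by (simp add: Tn_diff diff_eq_e Tn_in)
  then have "diff P (T Q) \<in> lvl 1" using kernel_Tn[OF j] P Q T_in diff_in by simp
  moreover have "T Q \<in> lvl 1" using Q by (simp add: lvl_def)
  ultimately have "star (neg (T Q)) (diff P (T Q)) \<in> lvl 1"
    using closedD[OF closed_lvl] by blast
  then show False using star_neg_diff Q T_in P by (simp add: lvl_def)
qed

lemma Tn_in_lvl: "P \<in> S \<Longrightarrow> i \<le> j \<Longrightarrow> (T ^^ j) P \<in> lvl i"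
  using lvl_antimono[of i j] by (metis imageI lvl_def subsetD)

lemma inj_on_Tn: "inj_on (T ^^ n) (lvl depth)"
proof (induction n)
  case (Suc n)
  have "(T ^^ n) ` lvl depth \<subseteq> lvl depth"
    using lvl_add[of n depth] lvl_antimono[of depth "n + depth"] by simp
  then have "inj_on T ((T ^^ n) ` lvl depth)"
    using inj_on_T[OF closed_lvl not_in_lvl_depth] inj_on_subset by blast
  then show ?case using Suc by (simp only: funpow.simps comp_inj_on)
qed simp

text \<open>From step \<^term>\<open>depth\<close> on the orbit stays in the set \<^term>\<open>lvl depth\<close>, on which
  \<^term>\<open>T\<close> is a permutation; at a step \<^term>\<open>i < depth\<close> it is in
  \<^term>\<open>lvl i\<close> but not in \<^term>\<open>lvl (Suc i)\<close>.\<close>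
lemma orbit_structure:
  assumes P: "P \<in> S" "P \<notin> T ` S"
  shows "((T ^^ depth) P = e \<and> (\<forall>i<depth. (T ^^ i) P \<noteq> e)) \<or>
    ((\<forall>i. (T ^^ i) P \<noteq> e) \<and>
     (\<exists>r\<ge>1. (T ^^ (depth + r)) P \<in> {(T ^^ depth) P, neg ((T ^^ depth) P)} \<and>
        (\<forall>i j. i < j \<longrightarrow> j < depth + r \<longrightarrow> (T ^^ j) P \<notin> {(T ^^ i) P, neg ((T ^^ i) P)})))"
proof -
  let ?R = "(T ^^ depth) P"
  have RL: "?R \<in> lvl depth" "neg ?R \<in> lvl depth"
    using Tn_in_lvl[OF P(1), of depth depth] closedD[OF closed_lvl] by auto
  have RS: "?R \<in> S" "neg ?R \<in> S" using P Tn_in neg_in by auto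
  have before: "(T ^^ i) P \<noteq> e" if "i < depth" for i
    using Tn_not_in_lvl[OF P that] closedD(2)[OF closed_lvl] by metis
  show ?thesis
  proof (cases "?R = e")
    case True then show ?thesis using before by blast
  next
    case False
    \<comment> \<open>Beyond \<open>depth\<close>, injectivity on \<open>lvl depth\<close> and
      \<open>T e = e\<close> keep the orbit away from \<open>e\<close>.\<close>
    have nonzero: "(T ^^ i) P \<noteq> e" for i
    proof (cases "i < depth")
      case False
      then have "(T ^^ i) P = (T ^^ (i - depth)) ?R"
        by (metis add.commute comp_apply funpow_add le_add_diff_inverse not_less)
      then show ?thesis
        using \<open>?R \<noteq> e\<close> inj_on_Tn[of "i - depth"] RL closedD(2)[OF closed_lvl] Tn_e
        by (metis inj_onD)
    qed (rule before)
    \<comment> \<open>Returns are counted up to sign, since a first coordinate determines a point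
      only up to \<open>neg\<close>.\<close>
    define ret where "ret r \<longleftrightarrow> r \<ge> 1 \<and> (T ^^ r) ?R \<in> {?R, neg ?R}" for r
    have returns: "ret (j - i)"
      if "i < j" "(T ^^ j) ?R \<in> {(T ^^ i) ?R, neg ((T ^^ i) ?R)}" for i j
    proof -
      have "(T ^^ i) ((T ^^ (j - i)) ?R) \<in> {(T ^^ i) ?R, (T ^^ i) (neg ?R)}"
        using that RS by (metis Tn_neg comp_apply funpow_add le_add_diff_inverse less_imp_le)
      moreover have "(T ^^ (j - i)) ?R \<in> lvl depth"
        using lvl_add[of "j - i" depth] lvl_antimono[of depth "j - i + depth"] RL by auto
      ultimately have "(T ^^ (j - i)) ?R \<in> {?R, neg ?R}"
        using inj_on_Tn[of i] RL by (auto dest: inj_onD)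
      then show ?thesis using that by (simp add: ret_def)
    qed
    have "\<exists>r. ret r"
    proof -
      have "range (\<lambda>i. (T ^^ i) ?R) \<subseteq> S" using Tn_in RS by blast
      then have "\<not> inj (\<lambda>i. (T ^^ i) ?R)"
        using finite_S finite_subset finite_imageD infinite_UNIV_nat by metis
      then obtain i j where "i < j" "(T ^^ j) ?R = (T ^^ i) ?R"
        unfolding inj_def by (metis linorder_neqE_nat)
      then show ?thesis using returns by blast
    qed
    define r where "r = (LEAST r. ret r)"
    have r: "ret r" and r_min: "\<And>r'. r' < r \<Longrightarrow> \<not> ret r'"
      unfolding r_def using \<open>\<exists>r. ret r\<close> by (metis LeastI, metis not_less_Least)
    have shift: "(T ^^ (depth + n)) P = (T ^^ n) ?R" for n
      by (metis add.commute comp_apply funpow_add)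
    have "(T ^^ j) P \<notin> {(T ^^ i) P, neg ((T ^^ i) P)}" if ij: "i < j" "j < depth + r" for i j
    proof
      assume eq: "(T ^^ j) P \<in> {(T ^^ i) P, neg ((T ^^ i) P)}"
      show False
      proof (cases "i < depth")
        case True
        \<comment> \<open>Before \<open>depth\<close> the level alone separates the points: step
          \<open>j > i\<close> is already in \<open>lvl (Suc i)\<close>, step \<open>i\<close> is
          not.\<close>
        have "(T ^^ j) P \<in> lvl (Suc i)" using Tn_in_lvl P ij by simp
        moreover have "(T ^^ i) P \<in> {(T ^^ j) P, neg ((T ^^ j) P)}"
          using eq neg_neg[OF Tn_in[OF P(1)]] by (metis insert_iff singletonD)
        ultimately have "(T ^^ i) P \<in> lvl (Suc i)" using closedD(4)[OF closed_lvl] by auto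
        then show ?thesis using Tn_not_in_lvl[OF P True] by blast
      next
        case False
        then have "ret ((j - depth) - (i - depth))"
          using returns[of "i - depth" "j - depth"] eq ij shift[of "i - depth"] shift[of "j - depth"]
          by simp
        then show ?thesis using r_min ij False by simp
      qed
    qed
    then show ?thesis using nonzero r shift by (auto simp: ret_def)
  qed
qed

end

subsection \<open>Collinear points and the 3-isogeny\<close>

text \<open>The last rule says that the line \<open>y = l x + n\<close> meets the curve exactly in the three points,
  with multiplicity: \<open>x\<^sup>3 + x\<^sup>2 - c - (l x + n)\<^sup>2 = (x - x1) (x - x2) (x - x3)\<close>.\<close>
inductive col :: "'a::field \<Rightarrow> ('a \<times> 'a) option \<Rightarrow> ('a \<times> 'a) option \<Rightarrow> ('a \<times> 'a) option \<Rightarrow> bool"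
  for c where
  triv: "col c None None None"
| opp1: "y\<^sup>2 = x ^ 3 + x\<^sup>2 - c \<Longrightarrow> col c (Some (x, y)) (Some (x, - y)) None"
| opp2: "y\<^sup>2 = x ^ 3 + x\<^sup>2 - c \<Longrightarrow> col c (Some (x, y)) None (Some (x, - y))"
| opp3: "y\<^sup>2 = x ^ 3 + x\<^sup>2 - c \<Longrightarrow> col c None (Some (x, y)) (Some (x, - y))"
| chord: "y1 = l * x1 + n \<Longrightarrow> y2 = l * x2 + n \<Longrightarrow> y3 = l * x3 + n \<Longrightarrow>
    x1 + x2 + x3 = l\<^sup>2 - 1 \<Longrightarrow> x1 * x2 + x1 * x3 + x2 * x3 = - 2 * l * n \<Longrightarrow>
    x1 * x2 * x3 = c + n\<^sup>2 \<Longrightarrow> col c (Some (x1, y1)) (Some (x2, y2)) (Some (x3, y3))"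

text \<open>With the other adjacent transposition and uniqueness of the third point, this yields
  commutativity and the law \<open>star P (star P Q) = Q\<close>.\<close>

lemma col_swap12: "col c P Q R \<Longrightarrow> col c Q P R"
proof (induction rule: col.induct)
  case (opp1 y x)
  then show ?case using col.opp1[of "- y" x c] by simp
next
  case (chord y1 l x1 n y2 x2 y3 x3)
  show ?case by (rule col.chord[of _ l _ n]) (use chord in \<open>simp_all add: algebra_simps\<close>)
qed (auto intro: triv opp1 opp2 opp3)

lemma col_swap23: "col c P Q R \<Longrightarrow> col c P R Q"
proof (induction rule: col.induct)
  case (opp3 y x)
  then show ?case using col.opp3[of "- y" x c] by simp
next
  case (chord y1 l x1 n y2 x2 y3 x3)
  show ?case by (rule col.chord[of _ l _ n]) (use chord in \<open>simp_all add: algebra_simps\<close>)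
qed (auto intro: triv opp1 opp2 opp3)

definition pts :: "'a::field \<Rightarrow> ('a \<times> 'a) option set" where
  "pts c = insert None (Some ` {(x, y). y\<^sup>2 = x ^ 3 + x\<^sup>2 - c})"

lemma pts_simps [simp]: "None \<in> pts c" "Some (x, y) \<in> pts c \<longleftrightarrow> y\<^sup>2 = x ^ 3 + x\<^sup>2 - c"
  by (auto simp: pts_def)

lemma col_imp_pts: "col c P Q R \<Longrightarrow> P \<in> pts c"
proof (induction rule: col.induct)
  case (chord y1 l x1 n y2 x2 y3 x3)
  \<comment> \<open>\<open>x1\<close> is a root of the monic cubic with roots \<open>x1\<close>,
    \<open>x2\<close>, \<open>x3\<close>; inserting the symmetric functions gives the curve
    equation.\<close>
  have "x1 ^ 3 - (x1 + x2 + x3) * x1\<^sup>2 + (x1 * x2 + x1 * x3 + x2 * x3) * x1 - x1 * x2 * x3 = 0"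
    by algebra
  then have "x1 ^ 3 - (l\<^sup>2 - 1) * x1\<^sup>2 + (- 2 * l * n) * x1 - (c + n\<^sup>2) = 0"
    unfolding chord .
  then show ?case unfolding pts_simps \<open>y1 = _\<close> by algebra
qed auto

lemma col_imp_pts': "col c P Q R \<Longrightarrow> P \<in> pts c \<and> Q \<in> pts c \<and> R \<in> pts c"
  by (meson col_imp_pts col_swap12 col_swap23)

text \<open>The slope of the tangent is \<^term>\<open>(3 * x\<^sup>2 + 2 * x) / (2 * y)\<close>, which is \<^term>\<open>x / y\<close>
  in characteristic 3.\<close>
fun third :: "('a::field \<times> 'a) option \<Rightarrow> ('a \<times> 'a) option \<Rightarrow> ('a \<times> 'a) option" where
  "third None None = None"
| "third None (Some (x, y)) = Some (x, - y)"
| "third (Some (x, y)) None = Some (x, - y)"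
| "third (Some (x1, y1)) (Some (x2, y2)) =
    (if x1 = x2 \<and> y1 = - y2 then None
     else let l = (if x1 = x2 then x1 / y1 else (y1 - y2) / (x1 - x2)); x3 = l\<^sup>2 - 1 - x1 - x2
          in Some (x3, l * (x3 - x1) + y1))"

definition frob :: "('a::field \<times> 'a) option \<Rightarrow> ('a \<times> 'a) option" where
  "frob = map_option (\<lambda>(x, y). (x ^ 3, y ^ 3))"

lemma frob_simps [simp]: "frob None = None" "frob (Some (x, y)) = Some (x ^ 3, y ^ 3)"
  by (simp_all add: frob_def)

text \<open>The separable 3-isogeny with kernel generated by \<open>(a, a)\<close>; composed with
  the Frobenius map it is multiplication by 3.\<close>
fun ver :: "'a::field \<Rightarrow> ('a \<times> 'a) option \<Rightarrow> ('a \<times> 'a) option" where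
  "ver a None = None"
| "ver a (Some (x, y)) = (if x = a then None else
     let w = x - a in Some ((w ^ 3 + a * w + a\<^sup>2) / w\<^sup>2, y * (w ^ 3 - a * w + a\<^sup>2) / w ^ 3))"

section \<open>The third intersection point in characteristic 3\<close>

context
  assumes three: "(3 :: 'a::field) = 0"
begin

lemma minus_eq_self: "- y = y \<Longrightarrow> y = (0 :: 'a)"
proof -
  assume "- y = y"
  then have "y + y = 0" by (metis add.right_inverse)
  \<comment> \<open>\<open>algebra\<close> does not know the characteristic, so it enters as an
    explicit multiple of 3 that \<open>three\<close> removes. Many later identities have this
    form.\<close>
  moreover have "y = 3 * y - (y + y)" by algebra
  ultimately show "y = 0" by (simp only: three) simp
qed

lemma col_third:
  fixes c :: 'a
  assumes P: "P \<in> pts c" and Q: "Q \<in> pts c"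
  shows "col c P Q (third P Q)"
proof (cases P; cases Q)
  fix p q assume pq: "P = Some p" "Q = Some q"
  obtain x1 y1 x2 y2 where xy: "p = (x1, y1)" "q = (x2, y2)" by fastforce
  have c1: "y1\<^sup>2 = x1 ^ 3 + x1\<^sup>2 - c" and c2: "y2\<^sup>2 = x2 ^ 3 + x2\<^sup>2 - c"
    using P Q pq xy by auto
  show ?thesis
  proof (cases "x1 = x2 \<and> y1 = - y2")
    case True
    then show ?thesis using c1 c2 col.opp1[OF c1] by (auto simp: pq xy)
  next
    case False
    define l where "l = (if x1 = x2 then x1 / y1 else (y1 - y2) / (x1 - x2))"
    define x3 where "x3 = l\<^sup>2 - 1 - x1 - x2"
    define n where "n = y1 - l * x1"
    have third: "third P Q = Some (x3, l * (x3 - x1) + y1)"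
      using False by (auto simp: pq xy l_def x3_def Let_def)
    have 1: "y2 = l * x2 + n \<and> x1 * x2 + x1 * x3 + x2 * x3 = - 2 * l * n"
    proof (cases "x1 = x2")
      case True
      have "(y1 - y2) * (y1 + y2) = 0" using c1 c2 True by algebra
      then have y: "y1 = y2" using False True by (auto simp: add_eq_0_iff)
      then have "y1 \<noteq> 0" using False True by auto
      then have l: "l * y1 = x1" using True by (simp add: l_def)
      have "x1 * x1 + x1 * x3 + x1 * x3 + 2 * l * n = 3 * (- x1 * x1) + 2 * (l * y1 - x1)"
        unfolding x3_def n_def True[symmetric] by algebra
      then show ?thesis using True y l three by (simp add: n_def eq_neg_iff_add_eq_0)
    next
      case x: False
      then have l: "l * (x1 - x2) = y1 - y2" by (simp add: l_def)
      \<comment> \<open>The difference of the two curve equations gives the wanted relation only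
        after multiplication by \<open>x1 - x2\<close>.\<close>
      have "(x1 - x2) * (x1 * x2 + x1 * x3 + x2 * x3 + 2 * l * n) = 0"
        using l c1 c2 unfolding x3_def n_def by algebra
      then have "x1 * x2 + x1 * x3 + x2 * x3 + 2 * l * n = 0" using x by simp
      moreover have "y2 = l * x2 + n" using l unfolding n_def by algebra
      ultimately show ?thesis by (simp add: eq_neg_iff_add_eq_0)
    qed
    have "x1 * x2 * x3 = x1 ^ 3 - (x1 + x2 + x3) * x1\<^sup>2 + (x1 * x2 + x1 * x3 + x2 * x3) * x1"
      by algebra
    also have "\<dots> = x1 ^ 3 - (l\<^sup>2 - 1) * x1\<^sup>2 + (- 2 * l * n) * x1"
      using 1 by (simp add: x3_def)
    also have "\<dots> = c + n\<^sup>2" using c1 unfolding n_def by algebra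
    finally have e3: "x1 * x2 * x3 = c + n\<^sup>2" .
    show ?thesis
      unfolding third unfolding pq xy
    proof (rule col.chord[of _ l _ n])
      show "l * (x3 - x1) + y1 = l * x3 + n" unfolding n_def by algebra
    qed (use 1 e3 in \<open>simp_all add: n_def x3_def\<close>)
  qed
qed (use assms in \<open>auto intro: triv opp1 opp2 opp3\<close>)

text \<open>The chord relations determine the slope. At a double point they give
  \<open>l * y1 = x1\<close>, and \<open>y1 = 0\<close> would force the singular point (0, 0), which
  lies on the curve only for \<open>c = 0\<close>.\<close>

lemma col_unique:
  fixes c :: 'a
  assumes "c \<noteq> 0" "col c P Q R" shows "R = third P Q"
  using assms(2)
proof (cases rule: col.cases)
  case (chord y1 l x1 n y2 x2 y3 x3)
  have x3: "x3 = l\<^sup>2 - 1 - x1 - x2" using chord by (simp add: algebra_simps)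
  have y3: "y3 = l * (x3 - x1) + y1" using chord by (simp add: algebra_simps)
  show ?thesis
  proof (cases "x1 = x2")
    case True
    have "l * y1 - x1 = - (x1 * x2 + x1 * x3 + x2 * x3 + 2 * l * n) + 3 * (l * y1 - x1 - x1\<^sup>2)"
      unfolding x3 True[symmetric] using chord(4) by algebra
    moreover have "x1 * x2 + x1 * x3 + x2 * x3 + 2 * l * n = 0" using chord(8) by simp
    ultimately have l: "l * y1 = x1" by (simp only: three) simp
    have "y1 \<noteq> 0"
    proof
      assume "y1 = 0"
      then have "x1 = 0" using l by simp
      moreover from this have "n = 0" using chord(4) \<open>y1 = 0\<close> by simp
      ultimately show False using chord(9) \<open>c \<noteq> 0\<close> by simp
    qed
    moreover have y2: "y2 = y1" using chord(4,5) True by simp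
    ultimately have "y1 \<noteq> - y2" using minus_eq_self[of y1] by metis
    moreover have "x1 / y1 = l" using l \<open>y1 \<noteq> 0\<close> by (simp add: field_simps)
    ultimately show ?thesis using True x3 y3 unfolding chord(1-3) y2 by (simp add: Let_def)
  next
    case False
    have "y1 - y2 = l * (x1 - x2)" unfolding chord(4,5) by algebra
    then have "(y1 - y2) / (x1 - x2) = l" using False by simp
    then show ?thesis using False x3 y3 unfolding chord(1-3) by (simp add: Let_def)
  qed
qed auto

section \<open>The Frobenius map\<close>

lemma cube_add: "(x + y) ^ 3 = x ^ 3 + (y :: 'a) ^ 3"
proof -
  have "(x + y) ^ 3 = x ^ 3 + y ^ 3 + 3 * (x\<^sup>2 * y + x * y\<^sup>2)" by algebra
  then show ?thesis by (simp add: three)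
qed

lemma cube_diff: "(x - y) ^ 3 = x ^ 3 - (y :: 'a) ^ 3"
  using cube_add[of "x - y" y] by (simp add: algebra_simps)

lemma cube_inj: "x ^ 3 = y ^ 3 \<longleftrightarrow> x = (y :: 'a)"
  using cube_diff[of x y] by auto

lemma cube_minus: "(- x) ^ 3 = - ((x :: 'a) ^ 3)"
  using cube_diff[of 0 x] by simp

lemma cube_two: "(2 :: 'a) ^ 3 = 2"
proof -
  have "(2 :: 'a) ^ 3 = 2 + 3 * 2" by simp
  then show ?thesis by (simp only: three mult_zero_left add_0_right)
qed

lemma power_swap3: "(x ^ 3) ^ k = ((x::'a) ^ k) ^ 3"
  by (simp add: mult.commute flip: power_mult)

lemma frob_curve: "y\<^sup>2 = x ^ 3 + x\<^sup>2 - (c :: 'a) \<Longrightarrow> (y ^ 3)\<^sup>2 = (x ^ 3) ^ 3 + (x ^ 3)\<^sup>2 - c ^ 3"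
  using arg_cong[of "y\<^sup>2" "x ^ 3 + x\<^sup>2 - c" "\<lambda>z. z ^ 3"]
  by (simp only: power_swap3[of _ 2] cube_add cube_diff)

lemma col_frob: "col (c :: 'a) P Q R \<Longrightarrow> col (c ^ 3) (frob P) (frob Q) (frob R)"
proof (induction rule: col.induct)
  case (chord y1 l x1 n y2 x2 y3 x3)
  show ?case unfolding frob_simps
  proof (rule col.chord[of _ "l ^ 3" _ "n ^ 3"])
    show "x1 ^ 3 + x2 ^ 3 + x3 ^ 3 = (l ^ 3)\<^sup>2 - 1"
      using arg_cong[OF chord(4), of "\<lambda>z. z ^ 3"] by (simp add: cube_add cube_diff power_swap3[of _ 2])
    show "x1 ^ 3 * x2 ^ 3 + x1 ^ 3 * x3 ^ 3 + x2 ^ 3 * x3 ^ 3 = - 2 * l ^ 3 * n ^ 3"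
      using arg_cong[OF chord(5), of "\<lambda>z. z ^ 3"]
      by (simp only: cube_add cube_minus power_mult_distrib cube_two mult_minus_left)
    show "x1 ^ 3 * x2 ^ 3 * x3 ^ 3 = c ^ 3 + (n ^ 3)\<^sup>2"
      using arg_cong[OF chord(6), of "\<lambda>z. z ^ 3"]
      by (simp add: cube_add power_mult_distrib power_swap3[of _ 2])
  qed (simp_all add: chord cube_add power_mult_distrib)
qed (simp_all only: frob_simps cube_minus, auto intro: triv opp1 opp2 opp3 dest: frob_curve)

section \<open>The 3-isogeny preserves collinearity\<close>

lemma curve_shift:
  assumes "y\<^sup>2 = x ^ 3 + x\<^sup>2 - (a :: 'a) ^ 3"
  shows "y\<^sup>2 = (x - a) ^ 3 + (x - a)\<^sup>2 - a * (x - a) + a\<^sup>2"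
proof -
  have "x ^ 3 + x\<^sup>2 - a ^ 3 = (x - a) ^ 3 + (x - a)\<^sup>2 - a * (x - a) + a\<^sup>2
      + 3 * (a * (x - a)\<^sup>2 + a\<^sup>2 * (x - a) + a * (x - a))"
    by algebra
  then show ?thesis using assms by (simp add: three)
qed

lemma ver_curve:
  fixes w a y :: 'a
  assumes y: "y\<^sup>2 = w ^ 3 + w\<^sup>2 - a * w + a\<^sup>2" and w: "w \<noteq> 0"
  shows "(y * (w ^ 3 - a * w + a\<^sup>2) / w ^ 3)\<^sup>2
    = ((w ^ 3 + a * w + a\<^sup>2) / w\<^sup>2) ^ 3 + ((w ^ 3 + a * w + a\<^sup>2) / w\<^sup>2)\<^sup>2 - a"
proof -
  let ?N = "w ^ 3 + a * w + a\<^sup>2"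
  have "(y * (w ^ 3 - a * w + a\<^sup>2))\<^sup>2 = ?N ^ 3 + ?N\<^sup>2 * w\<^sup>2 - a * w ^ 6
      + 3 * (- a * w ^ 6 - 2 * a * w ^ 7 - 2 * a ^ 3 * w ^ 3 - 4 * a ^ 3 * w ^ 4 - 2 * a ^ 5 * w)"
    using y by algebra
  then have "(y * (w ^ 3 - a * w + a\<^sup>2))\<^sup>2 = ?N ^ 3 + ?N\<^sup>2 * w\<^sup>2 - a * w ^ 6"
    by (simp add: three)
  then have "(y * (w ^ 3 - a * w + a\<^sup>2))\<^sup>2 / w ^ 6 = (?N ^ 3 + ?N\<^sup>2 * w\<^sup>2 - a * w ^ 6) / w ^ 6"
    by simp
  also have "\<dots> = (?N / w\<^sup>2) ^ 3 + (?N / w\<^sup>2)\<^sup>2 - a"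
    using w by (simp add: divide_simps) algebra
  finally show ?thesis by (simp add: power_divide flip: power_mult)
qed

text \<open>With \<open>w = x - a\<close>, the line \<open>y = l w + m\<close> is mapped to the line with slope \<^term>\<open>L / d\<close> and
  intercept \<^term>\<open>M / d\<close>. These values come from reducing \<open>y\<close> times the numerator of the second
  coordinate of \<^const>\<open>ver\<close> modulo the cubic satisfied by \<open>w\<close> on the line.\<close>
lemma symmetric_sums:
  fixes w1 w2 w3 l m a :: 'a
  assumes s1: "w1 + w2 + w3 = l\<^sup>2 - 1"
    and s2: "w1 * w2 + w1 * w3 + w2 * w3 = 2 * a - 2 * l * m"
    and s3: "w1 * w2 * w3 = m\<^sup>2 - a\<^sup>2"
  defines "N \<equiv> \<lambda>w. w ^ 3 + a * w + a\<^sup>2"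
    and "d \<equiv> a\<^sup>2 - m\<^sup>2"
    and "L \<equiv> l * (a\<^sup>2 - m\<^sup>2) - a * (a * l - m)"
    and "M \<equiv> m * (a\<^sup>2 - m\<^sup>2) - a * (a * l - m) * (1 - l\<^sup>2) - a\<^sup>2 * m"
  shows "N w1 * (w2 * w3)\<^sup>2 + N w2 * (w1 * w3)\<^sup>2 + N w3 * (w1 * w2)\<^sup>2 = L\<^sup>2 - d\<^sup>2"
    and "N w1 * N w2 * w3\<^sup>2 + N w1 * N w3 * w2\<^sup>2 + N w2 * N w3 * w1\<^sup>2 = - 2 * L * M"
    and "N w1 * N w2 * N w3 = a * d\<^sup>2 + M\<^sup>2"
proof -
  define e1 where "e1 = w1 + w2 + w3"
  define e2 where "e2 = w1 * w2 + w1 * w3 + w2 * w3"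
  define e3 where "e3 = w1 * w2 * w3"
  note e = s1[folded e1_def] s2[folded e2_def] s3[folded e3_def]
  have "N w1 * (w2 * w3)\<^sup>2 + N w2 * (w1 * w3)\<^sup>2 + N w3 * (w1 * w2)\<^sup>2
      = a * e2 * e3 - 2 * a\<^sup>2 * e1 * e3 + a\<^sup>2 * e2\<^sup>2 + e1 * e3\<^sup>2"
    unfolding N_def e1_def e2_def e3_def by algebra
  also have "\<dots> = L\<^sup>2 - d\<^sup>2 + 3 * (a^2*m^2 + (-2)*a^3*l*m + a^4*l^2)"
    unfolding e L_def d_def by algebra
  finally show "N w1 * (w2 * w3)\<^sup>2 + N w2 * (w1 * w3)\<^sup>2 + N w3 * (w1 * w2)\<^sup>2 = L\<^sup>2 - d\<^sup>2"
    by (simp add: three)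
  have "N w1 * N w2 * w3\<^sup>2 + N w1 * N w3 * w2\<^sup>2 + N w2 * N w3 * w1\<^sup>2
      = a*e1*e2*e3 + (-3)*a*e3^2 + a^2*e1*e2^2 + a^2*e1*e3 + (-2)*a^2*e1^2*e3 + (-1)*a^2*e2*e3 + a^3*e1*e2 + (-3)*a^3*e3 + a^4*e1^2 + (-2)*a^4*e2 + e2*e3^2"
    unfolding N_def e1_def e2_def e3_def by algebra
  also have "\<dots> = - 2 * L * M + 3 * ((-1)*a*m^4 + 2*a^2*l*m^3 + a^2*l^2*m^2 + (-1)*a^2*m^2 + 2*a^3*l*m + (-2)*a^3*l^3*m + (-1)*a^3*m^2 + (-1)*a^4*l^2 + a^4*l^4)"
    unfolding e L_def M_def by algebra
  finally show "N w1 * N w2 * w3\<^sup>2 + N w1 * N w3 * w2\<^sup>2 + N w2 * N w3 * w1\<^sup>2 = - 2 * L * M"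
    by (simp add: three)
  have "N w1 * N w2 * N w3
      = (-2)*a*e1*e3^2 + a*e2^2*e3 + (-3)*a^2*e1*e2*e3 + a^2*e1^2*e3 + (-2)*a^2*e2*e3 + a^2*e2^3 + 3*a^2*e3^2 + (-1)*a^3*e1*e3 + a^3*e1^2*e2 + (-2)*a^3*e2^2 + a^3*e3 + (-3)*a^4*e1*e2 + a^4*e1^3 + a^4*e2 + 3*a^4*e3 + a^5*e1 + a^6 + e3^3"
    unfolding N_def e1_def e2_def e3_def by algebra
  also have "\<dots> = a * d\<^sup>2 + M\<^sup>2 + 3 * (a*m^4 + (-4)*a^2*l*m^3 + 3*a^3*l^2*m^2 + 2*a^3*m^2 + (-2)*a^4*l*m)"
    unfolding e d_def M_def by algebra
  finally show "N w1 * N w2 * N w3 = a * d\<^sup>2 + M\<^sup>2"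
    by (simp add: three)
qed

lemma ver_line:
  fixes w l m a :: 'a
  assumes w: "w ^ 3 + (1 - l\<^sup>2) * w\<^sup>2 + (2 * a - 2 * l * m) * w + (a\<^sup>2 - m\<^sup>2) = 0"
    and w0: "w \<noteq> 0" and d: "a\<^sup>2 - m\<^sup>2 \<noteq> 0"
  defines "L \<equiv> l * (a\<^sup>2 - m\<^sup>2) - a * (a * l - m)"
    and "M \<equiv> m * (a\<^sup>2 - m\<^sup>2) - a * (a * l - m) * (1 - l\<^sup>2) - a\<^sup>2 * m"
  shows "(l * w + m) * (w ^ 3 - a * w + a\<^sup>2) / w ^ 3
    = L / (a\<^sup>2 - m\<^sup>2) * ((w ^ 3 + a * w + a\<^sup>2) / w\<^sup>2) + M / (a\<^sup>2 - m\<^sup>2)"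
proof -
  \<comment> \<open>The linear factor multiplying the cubic is the quotient, modulo 3, of the
    difference of the two cleared sides by that cubic.\<close>
  have "(l * w + m) * (w ^ 3 - a * w + a\<^sup>2) * (a\<^sup>2 - m\<^sup>2)
      = L * (w ^ 3 + a * w + a\<^sup>2) * w + M * w ^ 3
      + (a * (a * l - m) * w + a\<^sup>2 * m) * (w ^ 3 + (1 - l\<^sup>2) * w\<^sup>2 + (2 * a - 2 * l * m) * w + (a\<^sup>2 - m\<^sup>2))
      + 3 * (a^2*l*m^2*w + a^2*l^2*m*w^2 + (-1)*a^3*l*w^2 + (-1)*a^3*m*w)"
    unfolding L_def M_def by algebra
  also have "\<dots> = L * (w ^ 3 + a * w + a\<^sup>2) * w + M * w ^ 3" by (simp add: w three)
  finally have *: "(l * w + m) * (w ^ 3 - a * w + a\<^sup>2) * (a\<^sup>2 - m\<^sup>2)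
      = L * (w ^ 3 + a * w + a\<^sup>2) * w + M * w ^ 3" .
  have "L / D * (N / w\<^sup>2) + M / D = (L * N * w + M * w ^ 3) / (D * w ^ 3)" if "D \<noteq> 0" for D N
    using that w0 by (simp add: divide_simps) algebra
  from this[OF d] show ?thesis using * d w0 by (simp add: divide_simps mult.assoc)
qed

lemma ver_pts:
  fixes a :: 'a
  assumes "P \<in> pts (a ^ 3)" shows "ver a P \<in> pts a"
proof (cases P)
  case (Some p)
  then obtain x y where P: "P = Some (x, y)" by (cases p) auto
  then show ?thesis
    using assms ver_curve[OF curve_shift, of y x a] by (auto simp: Let_def)
qed simp

lemma ver_neg: "ver a (Some (x, - y)) = (case ver a (Some (x, y)) of None \<Rightarrow> None | Some (x', y') \<Rightarrow> Some (x', - y'))"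
  by (simp add: Let_def)

lemma col_neg: "P \<in> pts c \<Longrightarrow> col c P (case P of None \<Rightarrow> None | Some (x, y) \<Rightarrow> Some (x, - y)) None"
  by (cases P) (auto intro: triv opp1)

lemma cancel_two: "2 * x = 2 * y \<Longrightarrow> x = (y :: 'a)"
proof -
  assume "2 * x = 2 * y"
  then have "2 * (x - y) = 0" by (simp add: algebra_simps)
  moreover have "x - y = 3 * (x - y) - 2 * (x - y)" by algebra
  ultimately have "x - y = 0" by (simp only: three) simp
  then show ?thesis by simp
qed

text \<open>Moves the kernel abscissa \<open>a\<close> to 0; the line becomes
  \<open>y = l w + m\<close>. The product of the new abscissas shows that the line avoids the kernel
  exactly when \<open>a\<^sup>2 - m\<^sup>2\<close> is nonzero.\<close>

lemma chord_shift:
  fixes a l n :: 'a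
  assumes "x1 + x2 + x3 = l\<^sup>2 - 1" "x1 * x2 + x1 * x3 + x2 * x3 = - 2 * l * n"
    "x1 * x2 * x3 = a ^ 3 + n\<^sup>2"
  defines "w1 \<equiv> x1 - a" and "w2 \<equiv> x2 - a" and "w3 \<equiv> x3 - a" and "m \<equiv> n + l * a"
  shows "w1 + w2 + w3 = l\<^sup>2 - 1" "w1 * w2 + w1 * w3 + w2 * w3 = 2 * a - 2 * l * m"
    "w1 * w2 * w3 = m\<^sup>2 - a\<^sup>2"
proof -
  have "w1 + w2 + w3 = l\<^sup>2 - 1 + 3 * (- a)"
    unfolding w1_def w2_def w3_def using assms(1) by algebra
  then show "w1 + w2 + w3 = l\<^sup>2 - 1" by (simp add: three)
  have "w1 * w2 + w1 * w3 + w2 * w3 = 2 * a - 2 * l * m + 3 * a\<^sup>2"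
    unfolding w1_def w2_def w3_def m_def using assms(1,2) by algebra
  then show "w1 * w2 + w1 * w3 + w2 * w3 = 2 * a - 2 * l * m" by (simp add: three)
  show "w1 * w2 * w3 = m\<^sup>2 - a\<^sup>2"
    unfolding w1_def w2_def w3_def m_def using assms(1-3) by algebra
qed

text \<open>If the third point is in the kernel, the images of \<open>P\<close> and \<open>Q\<close>
  must be opposite. Here the general slope formula would divide by 0, so this case is computed
  directly.\<close>

lemma ver_chord_kernel:
  fixes a l n :: 'a
  assumes a: "a \<noteq> 0" and col: "col (a ^ 3) P Q (Some (a, y3))"
  shows "col a (ver a P) (ver a Q) None"
  using col
proof (cases rule: col.cases)
  case (chord y1 l x1 n y2 x2)
  define w1 where "w1 = x1 - a"
  define w2 where "w2 = x2 - a"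
  define m where "m = n + l * a"
  note w = chord_shift[OF chord(6-8), folded w1_def w2_def m_def, simplified]
  have s: "w1 + w2 = l\<^sup>2 - 1" and p: "w1 * w2 = 2 * a - 2 * l * m" and m: "m\<^sup>2 = a\<^sup>2"
    using w by simp_all
  have y: "y1 = l * w1 + m" "y2 = l * w2 + m"
    unfolding chord(3,4) w1_def w2_def m_def by algebra+
  \<comment> \<open>A second kernel point forces the third: \<open>a = l * m\<close> and
    \<open>m\<^sup>2 = a\<^sup>2\<close> give \<open>l\<^sup>2 = 1\<close>, so the sum of
    \<open>w1\<close> and \<open>w2\<close> vanishes.\<close>
  have both: "w1 = 0 \<and> w2 = 0" if "w1 * w2 = 0"
  proof -
    have "2 * a = 2 * (l * m)" using p that by algebra
    then have "a = l * m" by (rule cancel_two)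
    then have "a\<^sup>2 * (l\<^sup>2 - 1) = 0" using m by algebra
    then have "w1 + w2 = 0" using a s by simp
    then show ?thesis using that by auto
  qed
  show ?thesis
  proof (cases "w1 * w2 = 0")
    case True
    then show ?thesis using both by (auto simp: chord(1,2) w1_def w2_def triv)
  next
    case False
    then have nz: "w1 \<noteq> 0" "w2 \<noteq> 0" by auto
    let ?N = "\<lambda>w. w ^ 3 + a * w + a\<^sup>2" and ?G = "\<lambda>w. w ^ 3 - a * w + a\<^sup>2"
    have "?N w1 * w2\<^sup>2 - ?N w2 * w1\<^sup>2 = (w1 - w2) * ((w1 * w2)\<^sup>2 - a * (w1 * w2) - a\<^sup>2 * (w1 + w2))"
      by algebra
    also have "\<dots> = (w1 - w2) * (3 * (a\<^sup>2 - 2 * a * l * m + a\<^sup>2 * l\<^sup>2))"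
      unfolding s p using m by algebra
    finally have "?N w1 * w2\<^sup>2 = ?N w2 * w1\<^sup>2" by (simp add: three)
    then have x': "?N w1 / w1\<^sup>2 = ?N w2 / w2\<^sup>2" using nz by (simp add: divide_simps)
    define e1 where "e1 = w1 + w2"
    define e2 where "e2 = w1 * w2"
    note e = s[folded e1_def] p[folded e2_def]
    have "(l * w1 + m) * ?G w1 * w2 ^ 3 + (l * w2 + m) * ?G w2 * w1 ^ 3
      = (-1)*a*l*e2^2*e1 + (-1)*a*m*e2*e1^2 + 2*a*m*e2^2 + a^2*l*e2*e1^2 + (-2)*a^2*l*e2^2
        + (-3)*a^2*m*e2*e1 + a^2*m*e1^3 + l*e2^3*e1 + 2*m*e2^3"
      unfolding e1_def e2_def by algebra
    also have "\<dots> = 3 * (7*a^2*l^2*m - 3*a^2*l^4*m - 3*a^2*l^6*m - a^2*m + 22*a^3*l^2*m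
        - 8*a^3*l^3 + 8*a^3*l^5 + 10*a^3*m - 26*a^4*l - 6*a^4*l^3)"
      unfolding e using m by algebra
    finally have "(l * w1 + m) * ?G w1 * w2 ^ 3 = - ((l * w2 + m) * ?G w2 * w1 ^ 3)"
      by (simp add: three add_eq_0_iff)
    then have y': "y2 * ?G w2 / w2 ^ 3 = - (y1 * ?G w1 / w1 ^ 3)"
      using nz unfolding y by (simp add: divide_simps)
    have "ver a P \<in> pts a" using col_imp_pts[OF col] by (rule ver_pts)
    moreover have P: "ver a P = Some (?N w1 / w1\<^sup>2, y1 * ?G w1 / w1 ^ 3)"
      using nz by (simp add: chord(1) w1_def Let_def)
    moreover have "ver a Q = Some (?N w1 / w1\<^sup>2, - (y1 * ?G w1 / w1 ^ 3))"
      unfolding x' y'[symmetric] using nz by (simp add: chord(2) w2_def Let_def)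
    ultimately show ?thesis using col_neg[of "ver a P" a] by simp
  qed
qed (auto intro: triv)

lemma cubic_root:
  fixes w1 w2 w3 :: 'a
  assumes "w1 + w2 + w3 = e1" "w1 * w2 + w1 * w3 + w2 * w3 = e2" "w1 * w2 * w3 = e3"
    and "w \<in> {w1, w2, w3}"
  shows "w ^ 3 + (- e1) * w\<^sup>2 + e2 * w + (- e3) = 0"
proof -
  have "w ^ 3 + (- e1) * w\<^sup>2 + e2 * w + (- e3) = (w - w1) * (w - w2) * (w - w3)"
    unfolding assms(1-3)[symmetric] by algebra
  then show ?thesis using assms(4) by auto
qed

text \<open>Vertical lines use that the second coordinate of \<open>ver\<close> is odd in
  \<open>y\<close>; lines through the kernel use \<open>ver_chord_kernel\<close>; for all others the
  chord relations are \<open>symmetric_sums\<close> divided by \<open>d\<^sup>2\<close>.\<close>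

lemma col_ver:
  fixes a :: 'a
  assumes a: "a \<noteq> 0" and col: "col (a ^ 3) P Q R"
  shows "col a (ver a P) (ver a Q) (ver a R)"
  using col
proof (cases rule: col.cases)
  case (opp1 y x)
  then show ?thesis using col_neg[OF ver_pts] ver_neg col_imp_pts[OF col] by (metis ver.simps(1))
next
  case (opp2 y x)
  then show ?thesis
    using col_swap23[OF col_neg[OF ver_pts]] ver_neg col_imp_pts[OF col] by (metis ver.simps(1))
next
  case (opp3 y x)
  then have "Q \<in> pts (a ^ 3)" by simp
  then show ?thesis
    using col_swap12[OF col_swap23[OF col_neg[OF ver_pts]]] ver_neg opp3 by (metis ver.simps(1))
next
  case (chord y1 l x1 n y2 x2 y3 x3)
  consider "x1 = a" | "x2 = a" | "x3 = a" | "x1 \<noteq> a" "x2 \<noteq> a" "x3 \<noteq> a" by blast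
  then show ?thesis
  proof cases
    case 1
    then have "col a (ver a Q) (ver a R) None"
      using ver_chord_kernel[OF a] col_swap23[OF col_swap12[OF col]] chord(1) by blast
    then show ?thesis using 1 chord(1) col_swap12 col_swap23 by (metis ver.simps(2))
  next
    case 2
    then have "col a (ver a P) (ver a R) None"
      using ver_chord_kernel[OF a] col_swap23[OF col] chord(2) by blast
    then show ?thesis using 2 chord(2) col_swap23 by (metis ver.simps(2))
  next
    case 3
    then show ?thesis using ver_chord_kernel[OF a] col chord(3) by (metis ver.simps(2))
  next
    case 4
    define w1 where "w1 = x1 - a"
    define w2 where "w2 = x2 - a"
    define w3 where "w3 = x3 - a"
    define m where "m = n + l * a"
    define d where "d = a\<^sup>2 - m\<^sup>2"
    define L where "L = l * d - a * (a * l - m)"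
    define M where "M = m * d - a * (a * l - m) * (1 - l\<^sup>2) - a\<^sup>2 * m"
    let ?N = "\<lambda>w. w ^ 3 + a * w + a\<^sup>2" and ?G = "\<lambda>w. w ^ 3 - a * w + a\<^sup>2"
    note s = chord_shift[OF chord(7-9), folded w1_def w2_def w3_def m_def]
    note sums = symmetric_sums[OF s, folded d_def, folded L_def M_def]
    have nz: "w1 \<noteq> 0" "w2 \<noteq> 0" "w3 \<noteq> 0" using 4 by (auto simp: w1_def w2_def w3_def)
    have s3: "w1 * w2 * w3 = - d" using s(3) by (simp add: d_def)
    then have d: "d \<noteq> 0" using nz by auto
    have root: "w ^ 3 + (1 - l\<^sup>2) * w\<^sup>2 + (2 * a - 2 * l * m) * w + (a\<^sup>2 - m\<^sup>2) = 0"
      if "w \<in> {w1, w2, w3}" for w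
      using cubic_root[OF s that] by simp
    have line: "(l * w + m) * ?G w / w ^ 3 = L / d * (?N w / w\<^sup>2) + M / d" if "w \<in> {w1, w2, w3}" for w
      using ver_line[OF root[OF that]] that nz d unfolding L_def M_def d_def by auto
    have y: "y1 = l * w1 + m" "y2 = l * w2 + m" "y3 = l * w3 + m"
      unfolding chord(4-6) w1_def w2_def w3_def m_def by algebra+
    have dd: "d\<^sup>2 = (w1 * w2 * w3)\<^sup>2" unfolding s3 by simp
    have v: "ver a P = Some (?N w1 / w1\<^sup>2, y1 * ?G w1 / w1 ^ 3)"
      "ver a Q = Some (?N w2 / w2\<^sup>2, y2 * ?G w2 / w2 ^ 3)"
      "ver a R = Some (?N w3 / w3\<^sup>2, y3 * ?G w3 / w3 ^ 3)"
      using nz by (simp_all add: chord(1-3) w1_def w2_def w3_def Let_def)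
    have f: "n1 / w1\<^sup>2 + n2 / w2\<^sup>2 + n3 / w3\<^sup>2
        = (n1 * (w2 * w3)\<^sup>2 + n2 * (w1 * w3)\<^sup>2 + n3 * (w1 * w2)\<^sup>2) / (w1 * w2 * w3)\<^sup>2"
      "n1 / w1\<^sup>2 * (n2 / w2\<^sup>2) + n1 / w1\<^sup>2 * (n3 / w3\<^sup>2) + n2 / w2\<^sup>2 * (n3 / w3\<^sup>2)
        = (n1 * n2 * w3\<^sup>2 + n1 * n3 * w2\<^sup>2 + n2 * n3 * w1\<^sup>2) / (w1 * w2 * w3)\<^sup>2"
      "n1 / w1\<^sup>2 * (n2 / w2\<^sup>2) * (n3 / w3\<^sup>2) = (n1 * n2 * n3) / (w1 * w2 * w3)\<^sup>2"
      for n1 n2 n3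
      using nz by (simp_all add: power_mult_distrib add_divide_distrib)
    show ?thesis unfolding v
    proof (rule col.chord[of _ "L / d" _ "M / d"])
      show "?N w1 / w1\<^sup>2 + ?N w2 / w2\<^sup>2 + ?N w3 / w3\<^sup>2 = (L / d)\<^sup>2 - 1"
        unfolding f dd[symmetric] sums(1) using d by (simp add: diff_divide_distrib power_divide)
      show "?N w1 / w1\<^sup>2 * (?N w2 / w2\<^sup>2) + ?N w1 / w1\<^sup>2 * (?N w3 / w3\<^sup>2)
          + ?N w2 / w2\<^sup>2 * (?N w3 / w3\<^sup>2) = - 2 * (L / d) * (M / d)"
        unfolding f dd[symmetric] sums(2) using d by (simp add: power2_eq_square)
      show "?N w1 / w1\<^sup>2 * (?N w2 / w2\<^sup>2) * (?N w3 / w3\<^sup>2) = a + (M / d)\<^sup>2"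
        unfolding f dd[symmetric] sums(3) using d by (simp add: add_divide_distrib power_divide)
    qed (use line y in simp_all)
  qed
qed (auto intro: triv)

text \<open>The cover \<^term>\<open>ver a\<close> is the Artin-Schreier cover \<open>z - z\<^sup>3 = a y / x\<^sup>3\<close>.\<close>
lemma ver_artin_schreier:
  fixes a x y :: 'a
  assumes "Some (x, y) \<in> pts (a ^ 3)" "ver a (Some (x, y)) = Some (u, v)"
  shows "\<exists>z. a * v / u ^ 3 = z - z ^ 3"
proof (cases "u = 0")
  case False
  define w where "w = x - a"
  define N where "N = w ^ 3 + a * w + a\<^sup>2"
  have w: "w \<noteq> 0" and uv: "u = N / w\<^sup>2" "v = y * (w ^ 3 - a * w + a\<^sup>2) / w ^ 3"
    using assms(2) by (auto simp: w_def N_def Let_def split: if_splits)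
  have N: "N \<noteq> 0" using False uv by auto
  have y: "y\<^sup>2 = w ^ 3 + w\<^sup>2 - a * w + a\<^sup>2"
    using curve_shift assms(1) by (simp add: w_def)
  have "a\<^sup>2 * y\<^sup>2 - N\<^sup>2 + w ^ 3 * (w ^ 3 - a * w + a\<^sup>2) = 3 * (- a * w ^ 4 - a ^ 3 * w)"
    unfolding y N_def by algebra
  \<comment> \<open>The witness is \<open>z = a * y / N\<close>, for which \<open>z - z ^ 3\<close>
    has numerator \<open>a * y * (N\<^sup>2 - a\<^sup>2 * y\<^sup>2)\<close> over
    \<open>N ^ 3\<close>.\<close>
  then have key: "w ^ 3 * (w ^ 3 - a * w + a\<^sup>2) = N\<^sup>2 - a\<^sup>2 * y\<^sup>2"
    by (simp add: three algebra_simps)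
  have "a * v / u ^ 3 = a * y * (w ^ 3 * (w ^ 3 - a * w + a\<^sup>2)) / N ^ 3"
    unfolding uv using w N by (simp add: divide_simps)
  also have "\<dots> = a * y / N - (a * y / N) ^ 3"
    unfolding key using N by (simp add: divide_simps) algebra
  finally show ?thesis by blast
\<comment> \<open>For \<open>u = 0\<close> the quotient is 0 by the convention on division.\<close>
qed (auto intro: exI[of _ 0])

end

subsection \<open>Tripling\<close>

definition thrice :: "'a::field \<Rightarrow> ('a \<times> 'a) option \<Rightarrow> ('a \<times> 'a) option" where
  "thrice a P = ver a (frob P)"

context
  fixes a b :: "'a::{finite,field}"
  assumes three: "(3 :: 'a) = 0" and a: "a \<noteq> 0" and b: "b ^ 3 = a"
begin

lemma thrice_None [simp]: "thrice a None = None"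
  by (simp add: thrice_def)

text \<open>With \<open>w = x ^ 3 - a\<close> the numerator of the first coordinate of
  \<open>ver\<close> becomes that of the recursion.\<close>

lemma thrice_Some: "thrice a (Some (x, y)) = (if x = b then None else
    Some (((x ^ 3 - a) ^ 3 + a * x ^ 3) / (x ^ 3 - a)\<^sup>2,
      y ^ 3 * ((x ^ 3 - a) ^ 3 - a * (x ^ 3 - a) + a\<^sup>2) / (x ^ 3 - a) ^ 3))"
proof -
  have "x ^ 3 = a \<longleftrightarrow> x = b" using cube_inj[OF three, of x b] b by simp
  moreover have "(x ^ 3 - a) ^ 3 + a * (x ^ 3 - a) + a\<^sup>2 = (x ^ 3 - a) ^ 3 + a * x ^ 3" by algebra
  ultimately show ?thesis by (simp add: thrice_def Let_def)
qed

lemma frob_pts: "P \<in> pts a \<Longrightarrow> frob P \<in> pts (a ^ 3)"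
proof (cases P)
  case (Some p)
  assume "P \<in> pts a"
  then show ?thesis using Some
    by (cases p) (simp only: frob_simps pts_simps frob_curve[OF three])
qed simp

lemma thrice_pts: "P \<in> pts a \<Longrightarrow> thrice a P \<in> pts a"
  unfolding thrice_def using ver_pts[OF three] frob_pts by blast

lemma col_thrice: "col a P Q R \<Longrightarrow> col a (thrice a P) (thrice a Q) (thrice a R)"
  unfolding thrice_def using col_ver[OF three a] col_frob[OF three] by blast

text \<open>The tangent slope is \<open>x / y\<close>, so triple contact means
  \<open>(x / y)\<^sup>2 = 1 + 3 * x = 1\<close>; by the curve equation this is
  \<open>x ^ 3 = a\<close>.\<close>

lemma third_self_iff:
  assumes P: "P \<in> pts a" shows "third P P = P \<longleftrightarrow> thrice a P = None"
proof (cases P)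
  case (Some p)
  obtain x y where xy: "p = (x, y)" by fastforce
  have c: "y\<^sup>2 = x ^ 3 + x\<^sup>2 - a" using P Some xy by simp
  have iff: "thrice a P = None \<longleftrightarrow> x ^ 3 = a"
    using cube_inj[OF three, of x b] b by (simp add: Some xy thrice_Some)
  show ?thesis
  proof (cases "y = 0")
    case True
    then have "x ^ 3 \<noteq> a" using c a by auto
    then show ?thesis using True iff by (simp add: Some xy)
  next
    case False
    then have "y \<noteq> - y" using minus_eq_self[OF three, of y] by metis
    moreover have "(x / y)\<^sup>2 - 1 - x - x = x \<longleftrightarrow> x ^ 3 = a"
    proof -
      have "(x / y)\<^sup>2 - 1 - x - x = x \<longleftrightarrow> (x / y)\<^sup>2 = 1 + 3 * x" by (auto simp: algebra_simps)
      also have "\<dots> \<longleftrightarrow> x\<^sup>2 = y\<^sup>2" using False by (simp add: three power_divide divide_simps)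
      also have "\<dots> \<longleftrightarrow> x ^ 3 = a" using c by auto
      finally show ?thesis .
    qed
    ultimately show ?thesis unfolding iff by (auto simp: Some xy Let_def)
  qed
qed simp

interpretation E: star_system "pts a" None third "thrice a" "Some (b, b)"
proof
  show "finite (pts a)" by simp
  show "third P Q \<in> pts a" if "P \<in> pts a" "Q \<in> pts a" for P Q
    using col_third[OF three that] col_imp_pts' by blast
  show "third P Q = third Q P" if "P \<in> pts a" "Q \<in> pts a" for P Q
    using col_unique[OF three a] col_swap12[OF col_third[OF three that(2,1)]] by metis
  show "third P (third P Q) = Q" if "P \<in> pts a" "Q \<in> pts a" for P Q
    using col_unique[OF three a] col_swap23[OF col_third[OF three that]] by metis
  show "thrice a (third P Q) = third (thrice a P) (thrice a Q)"
    if "P \<in> pts a" "Q \<in> pts a" for P Q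
    using col_unique[OF three a] col_thrice[OF col_third[OF three that]] .
  have b0: "b \<noteq> 0" using a b by auto
  show "Some (b, b) \<in> pts a" using b by simp
  show "third None (Some (b, b)) \<noteq> Some (b, b)"
    using minus_eq_self[OF three, of b] b0 by (metis option.inject prod.inject third.simps(2))
  show "(thrice a P = None) = (P = None \<or> P = Some (b, b) \<or> P = third None (Some (b, b)))"
    if P: "P \<in> pts a" for P
  proof (cases P)
    case (Some p)
    obtain x y where xy: "p = (x, y)" by fastforce
    have "y = b \<or> y = - b" if "x = b"
    proof -
      have "y\<^sup>2 = b\<^sup>2" using P that b by (simp add: Some xy)
      then show ?thesis by (simp add: power2_eq_iff)
    qed
    then show ?thesis by (auto simp: Some xy thrice_Some)
  qed simp
qed (use thrice_pts third_self_iff in simp_all)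

lemma thrice_orbit:
  assumes P: "P \<in> pts a" "P \<notin> thrice a ` pts a"
  obtains k where "3 ^ k dvd card (pts a)" "\<not> 3 ^ (k + 1) dvd card (pts a)"
    and "((thrice a ^^ k) P = None \<and> (\<forall>i<k. (thrice a ^^ i) P \<noteq> None)) \<or>
    ((\<forall>i. (thrice a ^^ i) P \<noteq> None) \<and>
     (\<exists>r\<ge>1. (thrice a ^^ (k + r)) P \<in> {(thrice a ^^ k) P, third None ((thrice a ^^ k) P)} \<and>
        (\<forall>i j. i < j \<longrightarrow> j < k + r \<longrightarrow>
          (thrice a ^^ j) P \<notin> {(thrice a ^^ i) P, third None ((thrice a ^^ i) P)})))"
  using E.exact_power_card E.orbit_structure[OF P] by blast

lemma thrice_image:
  assumes P: "Some (u, v) \<in> thrice a ` pts a"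
  shows "\<exists>z. a * v / u ^ 3 = z - z ^ 3"
proof -
  obtain Q where Q: "Q \<in> pts a" "Some (u, v) = ver a (frob Q)"
    using P by (auto simp: thrice_def)
  then obtain x y where "frob Q = Some (x, y)" by (cases "frob Q") auto
  then show ?thesis using ver_artin_schreier[OF three, of x y a u v] frob_pts[OF Q(1)] Q(2) by simp
qed

text \<open>Indices shift by one: \<open>P i\<close> has first coordinate \<open>u (Suc i)\<close>.
  As \<open>b\<close> is the abscissa of the kernel, \<open>u (Suc i) = b\<close> exactly when
  \<open>P (Suc i)\<close> is the point at infinity.\<close>

lemma orbit_coordinates:
  fixes u :: "nat \<Rightarrow> 'a"
  assumes m: "Some (u 1, y) \<in> pts a" "Some (u 1, y) \<notin> thrice a ` pts a"
    and u: "\<And>i. i \<ge> 1 \<Longrightarrow> u i \<noteq> b \<Longrightarrow>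
      u (Suc i) = ((u i ^ 3 - a) ^ 3 + a * u i ^ 3) / (u i ^ 3 - a)\<^sup>2"
  shows "\<exists>k. 3 ^ k dvd card (pts a) \<and> \<not> 3 ^ (k + 1) dvd card (pts a) \<and>
     ((1 \<le> k \<and> u k = b \<and> (\<forall>i. 1 \<le> i \<and> i < k \<longrightarrow> u i \<noteq> b))
      \<or> (\<exists>r::nat. r \<ge> 1 \<and> u (k + 1) = u (k + 1 + r)
           \<and> (\<forall>i. 1 \<le> i \<and> i < k + 1 + r \<longrightarrow> u i \<noteq> b)
           \<and> (\<forall>i j. 1 \<le> i \<and> i < j \<and> j < k + 1 + r \<longrightarrow> u i \<noteq> u j)))"
proof -
  define P where "P i = (thrice a ^^ i) (Some (u 1, y))" for i
  have P_Suc: "P (Suc i) = thrice a (P i)" and P_0: "P 0 = Some (u 1, y)" for i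
    by (simp_all add: P_def)
  have pts: "P i \<in> pts a" for i
    by (induction i) (use m thrice_pts in \<open>auto simp only: P_Suc P_0\<close>)
  have coord: "\<exists>y. P i = Some (u (Suc i), y)" if "P i \<noteq> None" for i
    using that
  proof (induction i)
    case 0
    then show ?case by (simp add: P_0)
  next
    case (Suc i)
    then have "P i \<noteq> None" by (metis P_Suc thrice_None)
    then obtain y where y: "P i = Some (u (Suc i), y)" using Suc by blast
    then have "u (Suc i) \<noteq> b" using Suc by (auto simp: P_Suc thrice_Some)
    then show ?case using y u[of "Suc i"] by (simp add: P_Suc thrice_Some)
  qed
  have u_b: "u (Suc i) = b \<longleftrightarrow> P (Suc i) = None" if "P i \<noteq> None" for i
    using coord[OF that] by (auto simp: P_Suc thrice_Some split: if_splits)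
  have same: "u (Suc i) = u (Suc j) \<longleftrightarrow> P j \<in> {P i, third None (P i)}"
    if ij: "P i \<noteq> None" "P j \<noteq> None" for i j
  proof -
    obtain y z where yz: "P i = Some (u (Suc i), y)" "P j = Some (u (Suc j), z)"
      using coord[OF ij(1)] coord[OF ij(2)] by blast
    have "z = y \<or> z = - y" if "u (Suc i) = u (Suc j)"
    proof -
      have "z\<^sup>2 = y\<^sup>2" using pts[of i] pts[of j] yz that by simp
      then show ?thesis by (simp add: power2_eq_iff)
    qed
    then show ?thesis using yz by auto
  qed
  obtain k where k: "3 ^ k dvd card (pts a)" "\<not> 3 ^ (k + 1) dvd card (pts a)"
    and orbit: "(P k = None \<and> (\<forall>i<k. P i \<noteq> None)) \<or>
      ((\<forall>i. P i \<noteq> None) \<and> (\<exists>r\<ge>1. P (k + r) \<in> {P k, third None (P k)} \<and>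
        (\<forall>i j. i < j \<longrightarrow> j < k + r \<longrightarrow> P j \<notin> {P i, third None (P i)})))"
    using thrice_orbit[OF m] unfolding P_def by metis
  show ?thesis
    using orbit
  proof (elim disjE conjE exE)
    assume *: "P k = None" "\<forall>i<k. P i \<noteq> None"
    then have "k \<noteq> 0" using P_0 by (metis option.distinct(1))
    then obtain k' where k': "k = Suc k'" by (cases k) auto
    have "u k = b" using u_b[of k'] * k' by simp
    moreover have "u i \<noteq> b" if "1 \<le> i" "i < k" for i
      using u_b[of "i - 1"] * that by simp
    moreover have "1 \<le> k" using \<open>k \<noteq> 0\<close> by simp
    ultimately show ?thesis using k by blast
  next
    fix r assume nN: "\<forall>i. P i \<noteq> None" and r: "1 \<le> r" "P (k + r) \<in> {P k, third None (P k)}"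
      "\<forall>i j. i < j \<longrightarrow> j < k + r \<longrightarrow> P j \<notin> {P i, third None (P i)}"
    have "u (k + 1) = u (k + 1 + r)" using same[of k "k + r"] nN r(2) by simp
    moreover have "u i \<noteq> b" if "1 \<le> i" for i
      using u_b[of "i - 1"] nN that by simp
    moreover have "u i \<noteq> u j" if "1 \<le> i" "i < j" "j < k + 1 + r" for i j
    proof -
      have "P (j - 1) \<notin> {P (i - 1), third None (P (i - 1))}"
        using r(3) that by simp
      then show ?thesis using same[of "i - 1" "j - 1"] nN that by simp
    qed
    ultimately show ?thesis using k r(1) by metis
  qed
qed

end

subsection \<open>The Kloosterman sum as a point count\<close>

lemma of_nat_card_UNIV: "of_nat (card (UNIV :: 'a::{finite,field} set)) = (0 :: 'a)"
proof -
  have "(\<Sum>x\<in>UNIV. x + 1 :: 'a) = (\<Sum>x\<in>UNIV. x)"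
    by (rule sum.reindex_bij_witness[of _ "\<lambda>x. x - 1" "\<lambda>x. x + 1"]) auto
  then show ?thesis by (simp add: sum.distrib)
qed

lemma power_card_UNIV: "x ^ card (UNIV :: 'a::{finite,field} set) = (x :: 'a)"
proof (cases "x = 0")
  case False
  have "(\<Prod>y\<in>UNIV - {0}. x * y) = (\<Prod>y\<in>UNIV - {0}. y)"
    by (rule prod.reindex_bij_witness[of _ "\<lambda>y. y / x" "\<lambda>y. x * y"]) (use False in auto)
  then have "x ^ (card (UNIV :: 'a set) - 1) = 1"
    by (simp add: prod.distrib card_Diff_singleton)
  then have "x ^ Suc (card (UNIV :: 'a set) - 1) = x" by simp
  then show ?thesis by (simp add: Suc_diff_1 finite_UNIV_card_ge_0)
qed (simp add: finite_UNIV_card_ge_0)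

section \<open>Sums of the quadratic character\<close>

lemma sum_fibers:
  fixes h :: "'b::finite \<Rightarrow> int" and g :: "'c::finite \<Rightarrow> 'b"
  shows "(\<Sum>z\<in>UNIV. h (g z)) = (\<Sum>v\<in>UNIV. int (card {z. g z = v}) * h v)"
proof -
  have "(\<Sum>z\<in>UNIV. h (g z)) = (\<Sum>v\<in>UNIV. \<Sum>z\<in>{z \<in> UNIV. g z = v}. h (g z))"
    by (rule sum.group[symmetric]) auto
  also have "\<dots> = (\<Sum>v\<in>UNIV. int (card {z. g z = v}) * h v)"
    by (intro sum.cong) auto
  finally show ?thesis .
qed

lemma sum_card_swap:
  "(\<Sum>x\<in>(UNIV :: 'b::finite set). int (card {z :: 'c::finite. Q x z}))
    = (\<Sum>z\<in>UNIV. int (card {x. Q x z}))"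
proof -
  have *: "int (card {z. R z}) = (\<Sum>z\<in>UNIV. if R z then 1 else 0)" for R :: "'d::finite \<Rightarrow> bool"
    by (simp add: sum.If_cases)
  show ?thesis unfolding * by (rule sum.swap)
qed

text \<open>The quadratic character, defined by counting square roots so that point counts become
  character sums directly.\<close>

definition chi :: "'a::{finite,field} \<Rightarrow> int" where
  "chi v = int (card {y. y\<^sup>2 = v}) - 1"

lemma sum_squares:
  fixes h :: "'a::{finite,field} \<Rightarrow> int"
  shows "(\<Sum>z\<in>UNIV. h (z\<^sup>2)) = (\<Sum>v\<in>UNIV. h v) + (\<Sum>v\<in>UNIV. chi v * h v)"
  by (simp add: sum_fibers[of h "\<lambda>z. z\<^sup>2"] chi_def algebra_simps sum_subtractf)

lemma sum_chi: "(\<Sum>v\<in>(UNIV :: 'a::{finite,field} set). chi v) = 0"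
  using sum_squares[of "\<lambda>_ :: 'a. 1"] by simp

lemma chi_square_mult:
  assumes "s \<noteq> 0" shows "chi (s\<^sup>2 * v) = chi v"
proof -
  have "bij_betw ((*) s) {y. y\<^sup>2 = v} {y. y\<^sup>2 = s\<^sup>2 * v}"
    by (rule bij_betw_byWitness[where f' = "\<lambda>y. y / s"])
      (use assms in \<open>auto simp: power_mult_distrib power_divide\<close>)
  then show ?thesis unfolding chi_def by (simp add: bij_betw_same_card)
qed

lemma chi_0: "chi 0 = 0"
  by (simp add: chi_def)

lemma chi_le_1: "chi v \<le> 1"
proof (cases "\<exists>s. v = s\<^sup>2")
  case True
  then obtain s where "v = s\<^sup>2" by blast
  then have "{y. y\<^sup>2 = v} \<subseteq> {s, - s}" by (auto simp: power2_eq_iff)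
  then have "card {y. y\<^sup>2 = v} \<le> card {s, - s}" by (intro card_mono) auto
  also have "\<dots> \<le> 2" by (simp add: card_insert_if)
  finally show ?thesis by (simp add: chi_def)
next
  case False
  then have "{y. y\<^sup>2 = v} = {}" by auto
  then show ?thesis by (simp add: chi_def)
qed

lemma chi_nonsquare: "(\<And>s. v \<noteq> s\<^sup>2) \<Longrightarrow> chi v = -1"
  by (metis (mono_tags, lifting) Collect_empty_eq add.left_neutral card.empty chi_def diff_0 of_nat_0)

context
  assumes three: "(3 :: 'a::{finite,field}) = 0"
begin

lemma chi_square: "s \<noteq> 0 \<Longrightarrow> chi (s\<^sup>2 :: 'a) = 1"
proof -
  assume s: "s \<noteq> 0"
  have "{y. y\<^sup>2 = s\<^sup>2} = {s, - s}" by (auto simp: power2_eq_iff)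
  moreover have "s \<noteq> - s" using minus_eq_self[OF three, of s] s by metis
  ultimately show ?thesis by (simp add: chi_def)
qed

lemma sum_injective:
  fixes f :: "'a \<Rightarrow> 'a" and h :: "'a \<Rightarrow> int"
  assumes "inj f" shows "(\<Sum>x\<in>UNIV. h (f x)) = (\<Sum>x\<in>UNIV. h x)"
  using sum.reindex[of f UNIV h] assms finite_UNIV_inj_surj[of f] by simp

text \<open>Multiplication by a nonsquare \<^term>\<open>u\<close> cannot preserve the value 1, so
  \<^term>\<open>chi (u * v) + chi v \<le> 0\<close>; since both characters sum to 0, equality holds.\<close>
lemma chi_mult: "chi (u * v) = chi u * chi (v :: 'a)"
proof (cases "\<exists>s. u = s\<^sup>2")
  case True
  then obtain s where s: "u = s\<^sup>2" by blast
  then show ?thesis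
    by (cases "s = 0") (simp_all add: chi_0 chi_square_mult chi_square)
next
  case False
  then have u: "chi u = -1" "u \<noteq> 0" using chi_nonsquare[of u] by (blast, metis power_zero_numeral)
  have le: "chi (u * v) + chi v \<le> 0" for v
  proof (cases "\<exists>s. v = s\<^sup>2")
    case True
    then obtain s where s: "v = s\<^sup>2" by blast
    show ?thesis
    proof (cases "s = 0")
      case False
      then have "chi (u * v) = chi u" using chi_square_mult[of s u] s by (simp add: mult.commute)
      then show ?thesis using u s chi_square False by simp
    qed (simp add: s chi_0)
  next
    case False
    then show ?thesis using chi_nonsquare[of v] chi_le_1[of "u * v"] by auto
  qed
  have "(\<Sum>v\<in>UNIV. chi (u * v)) = (\<Sum>v\<in>(UNIV :: 'a set). chi v)"
    by (rule sum_injective[of "(*) u" chi]) (use u in \<open>simp add: inj_def\<close>)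
  then have "(\<Sum>v\<in>UNIV. - (chi (u * v) + chi v)) = 0"
    by (simp add: sum.distrib sum_negf sum_chi sum_subtractf)
  then have "chi (u * v) + chi v = 0"
    using sum_nonneg_eq_0_iff[of UNIV "\<lambda>v. - (chi (u * v) + chi v)"] le
    by (simp del: minus_add_distrib)
  then show ?thesis using u by simp
qed

lemma card_pts:
  fixes a :: 'a
  shows "int (card (pts a)) = int (card (UNIV :: 'a set)) + 1 + (\<Sum>x\<in>UNIV. chi (x ^ 3 + x\<^sup>2 - a))"
proof -
  have "card (pts a) = 1 + card {(x, y). y\<^sup>2 = x ^ 3 + x\<^sup>2 - a}"
    unfolding pts_def by (subst card_insert_disjoint) (auto simp: card_image)
  also have "{(x, y). y\<^sup>2 = x ^ 3 + x\<^sup>2 - a} = (SIGMA x:UNIV. {y. y\<^sup>2 = x ^ 3 + x\<^sup>2 - a})" by auto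
  finally show ?thesis by (simp add: chi_def sum_subtractf)
qed

text \<open>The double cover \<open>w\<^sup>2 = (z\<^sup>3 - z)\<^sup>2 - a\<close> of the \<open>z\<close>-line factors through \<open>z\<^sup>2\<close>; its two
  quotients are both isogenous to the curve.\<close>
lemma sum_chi_cover:
  fixes a :: 'a
  assumes a: "a \<noteq> 0"
  shows "(\<Sum>z\<in>UNIV. chi ((z ^ 3 - z)\<^sup>2 - a)) = 2 * (\<Sum>x\<in>UNIV. chi (x ^ 3 + x\<^sup>2 - a)) - 1"
proof -
  define F where "F x = x ^ 3 + x\<^sup>2 - a" for x
  define G where "G w = w ^ 3 + w\<^sup>2 + w - a" for w
  define H where "H s = 1 + s + s\<^sup>2 - a * s ^ 3" for s
  have "(z ^ 3 - z)\<^sup>2 - a = G (z\<^sup>2)" for z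
  proof -
    have "(z ^ 3 - z)\<^sup>2 - a = G (z\<^sup>2) - 3 * z ^ 4" unfolding G_def by algebra
    then show ?thesis by (simp add: three)
  qed
  then have "(\<Sum>z\<in>UNIV. chi ((z ^ 3 - z)\<^sup>2 - a)) = (\<Sum>w\<in>UNIV. chi (G w)) + (\<Sum>w\<in>UNIV. chi (w * G w))"
    using sum_squares[of "\<lambda>w. chi (G w)"] by (simp add: chi_mult)
  also have "(\<Sum>w\<in>UNIV. chi (G w)) = (\<Sum>x\<in>UNIV. chi (F x))"
  proof -
    have "F x = G (x + 1)" for x
    proof -
      have "G (x + 1) = F x + 3 * (x\<^sup>2 + 2 * x + 1)" unfolding F_def G_def by algebra
      then show ?thesis by (simp add: three)
    qed
    then show ?thesis using sum_injective[of "\<lambda>x. x + 1" "\<lambda>w. chi (G w)"] by (simp add: inj_def)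
  qed
  \<comment> \<open>Inversion turns \<open>w * G w\<close> into \<open>H\<close> up to a square.
    Since \<open>inverse 0 = 0\<close>, it permutes the whole field; the summand at 0 is 0 before
    and \<open>chi (H 0) = 1\<close> after, whence the \<open>- 1\<close>.\<close>
  also have "(\<Sum>w\<in>UNIV. chi (w * G w)) = (\<Sum>x\<in>UNIV. chi (F x)) - 1"
  proof -
    have "chi (w * G w) = chi (H (inverse w))" if "w \<noteq> 0" for w
    proof -
      have "w * G w = (w\<^sup>2)\<^sup>2 * H (inverse w)"
        unfolding G_def H_def using that by (simp add: field_simps) algebra
      then show ?thesis using chi_square_mult[of "w\<^sup>2"] that by simp
    qed
    then have "(\<Sum>w\<in>UNIV - {0}. chi (w * G w)) = (\<Sum>w\<in>UNIV - {0}. chi (H (inverse w)))"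
      by (intro sum.cong) auto
    then have "(\<Sum>w\<in>UNIV. chi (w * G w)) = (\<Sum>w\<in>UNIV. chi (H (inverse w))) - chi (H 0)"
      by (simp add: sum_diff1 chi_0)
    also have "chi (H 0) = 1" using chi_square[of 1] by (simp add: H_def)
    also have "(\<Sum>w\<in>UNIV. chi (H (inverse w))) = (\<Sum>s\<in>UNIV. chi (H s))"
      by (rule sum_injective) (simp add: inj_def)
    \<comment> \<open>Cubing is injective, so \<open>1 - t ^ 3 / a\<close> runs over the field; the
      substitution turns \<open>H\<close> into \<open>F t ^ 3 / a\<^sup>2\<close>, which is
      \<open>F t\<close> times a square.\<close>
    also have "\<dots> = (\<Sum>t\<in>UNIV. chi (H (1 - t ^ 3 / a)))"
      by (rule sum_injective[symmetric]) (use a cube_inj[OF three] in \<open>auto simp: inj_def\<close>)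
    also have "\<dots> = (\<Sum>t\<in>UNIV. chi (F t))"
    proof (rule sum.cong[OF refl])
      fix t
      define r where "r = - (t ^ 3 / a)"
      have "H (1 + r) = r\<^sup>2 - a - a * r ^ 3 + 3 * (1 + r - a * r - a * r\<^sup>2)"
        unfolding H_def by algebra
      also have "\<dots> = r\<^sup>2 - a - a * r ^ 3" by (simp add: three)
      also have "\<dots> = ((t ^ 3) ^ 3 + (t\<^sup>2) ^ 3 - a ^ 3) / a\<^sup>2"
        unfolding r_def using a by (simp add: field_simps) algebra
      also have "(t ^ 3) ^ 3 + (t\<^sup>2) ^ 3 - a ^ 3 = F t ^ 3"
        by (simp only: F_def cube_add[OF three] cube_diff[OF three])
      also have "F t ^ 3 / a\<^sup>2 = (F t / a)\<^sup>2 * F t"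
        by (simp add: power_divide power3_eq_cube power2_eq_square)
      finally have "H (1 - t ^ 3 / a) = (F t / a)\<^sup>2 * F t" by (simp add: r_def)
      then show "chi (H (1 - t ^ 3 / a)) = chi (F t)"
        using chi_square_mult[of "F t / a" "F t"] a by (cases "F t = 0") auto
    qed
    finally show ?thesis .
  qed
  finally show ?thesis by (simp add: F_def)
qed

end

section \<open>The trace and the Artin-Schreier equation\<close>

context
  fixes m :: nat
  assumes m: "m \<ge> 1" and card_UNIV: "card (UNIV :: 'a::{finite,field} set) = 3 ^ m"
begin

lemma three_eq_0: "(3 :: 'a) = 0"
proof -
  have "(3 :: 'a) ^ m = 0" using of_nat_card_UNIV[where 'a = 'a] card_UNIV by simp
  then show ?thesis using power_not_zero by blast
qed

lemmas three = three_eq_0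

lemma power_3_power_add: "(x + y) ^ (3 ^ i) = x ^ (3 ^ i) + (y :: 'a) ^ (3 ^ i)"
  by (induction i) (simp_all add: power_mult cube_add[OF three] mult.commute[of 3])

lemma Tr_add: "Tr m (x + y) = Tr m x + Tr m (y :: 'a)"
  by (simp add: Tr_def power_3_power_add sum.distrib)

lemma Tr_minus: "Tr m (- x) = - Tr m (x :: 'a)"
proof -
  have "Tr m 0 = (0 :: 'a)" by (simp add: Tr_def power_0_left)
  then show ?thesis using Tr_add[of x "- x"] by (simp add: eq_neg_iff_add_eq_0 add.commute)
qed

lemma Tr_cube: "Tr m (x ^ 3) = Tr m (x :: 'a)"
proof -
  have "Tr m (x ^ 3) + x = (\<Sum>i<Suc m. x ^ 3 ^ i)"
    by (simp add: Tr_def sum.lessThan_Suc_shift power_mult del: sum.lessThan_Suc)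
  also have "\<dots> = Tr m x + x" using power_card_UNIV[of x] by (simp add: Tr_def card_UNIV)
  finally show ?thesis by simp
qed

lemma cube_sum: "finite A \<Longrightarrow> (\<Sum>i\<in>A. f i) ^ 3 = (\<Sum>i\<in>A. (f i :: 'a) ^ 3)"
  by (induction rule: finite_induct) (simp_all add: cube_add[OF three])

lemma fixed_by_cube: "t ^ 3 = t \<longleftrightarrow> t \<in> {0, 1, -1 :: 'a}"
proof -
  have "t ^ 3 - t = t * (t - 1) * (t + 1)" by algebra
  then have "t ^ 3 = t \<longleftrightarrow> t * (t - 1) * (t + 1) = 0" by (metis eq_iff_diff_eq_0)
  then show ?thesis by (auto simp: eq_neg_iff_add_eq_0)
qed

text \<open>The trace is fixed by cubing.\<close>

lemma Tr_cases: "Tr m (x :: 'a) \<in> {0, 1, -1}"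
proof -
  have "Tr m x ^ 3 = Tr m (x ^ 3)"
    by (simp add: Tr_def cube_sum mult.commute flip: power_mult)
  then show ?thesis using Tr_cube fixed_by_cube by simp
qed

lemma Tr_artin_schreier: "Tr m (z ^ 3 - z) = (0 :: 'a)"
  using Tr_add[of "z ^ 3" "- z"] by (simp add: Tr_minus Tr_cube)

lemma one_neq_minus_one: "(1 :: 'a) \<noteq> -1"
  using minus_eq_self[OF three, of 1] by auto

lemma artin_schreier_fiber:
  assumes "v = z ^ 3 - (z :: 'a)" shows "card {z. z ^ 3 - z = v} = 3"
proof -
  have "y ^ 3 - y = v \<longleftrightarrow> y - z \<in> {0, 1, -1}" for y
    unfolding assms fixed_by_cube[symmetric] cube_diff[OF three] by (auto simp: algebra_simps)
  then have "{y. y ^ 3 - y = v} = {y. y - z \<in> {0, 1, -1}}" by blast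
  moreover have "bij_betw (\<lambda>y. y - z) {y. y - z \<in> {0, 1, -1}} {0, 1, -1}"
    by (rule bij_betw_byWitness[where f' = "\<lambda>y. y + z"]) auto
  moreover have "card {0, 1, -1 :: 'a} = 3" using one_neq_minus_one by simp
  ultimately show ?thesis by (simp add: bij_betw_same_card)
qed

text \<open>The trace is a polynomial of degree \<open>3 ^ (m - 1)\<close>.\<close>

lemma Tr_kernel_card: "card {x :: 'a. Tr m x = 0} \<le> 3 ^ (m - 1)"
proof -
  define p :: "'a poly" where "p = (\<Sum>i<m. monom 1 (3 ^ i))"
  have "coeff p (3 ^ (m - 1)) = (\<Sum>i<m. if i = m - 1 then 1 else 0)"
    unfolding p_def coeff_sum by (intro sum.cong) (auto simp: power_inject_exp)
  then have "coeff p (3 ^ (m - 1)) = 1" using m by simp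
  then have "p \<noteq> 0" by auto
  moreover have "poly p x = Tr m x" for x by (simp add: p_def Tr_def poly_sum poly_monom)
  moreover have "degree p \<le> 3 ^ (m - 1)"
    unfolding p_def
  proof (rule degree_sum_le)
    fix i assume "i \<in> {..<m}"
    then have "(3 :: nat) ^ i \<le> 3 ^ (m - 1)" by (intro power_increasing) auto
    then show "degree (monom (1 :: 'a) (3 ^ i)) \<le> 3 ^ (m - 1)"
      using degree_monom_le le_trans by blast
  qed simp
  ultimately show ?thesis using card_poly_roots_bound[of p] by simp
qed

text \<open>Additive Hilbert 90 by counting: all nonempty fibres have 3 elements, so the image has
  \<open>3 ^ (m - 1)\<close> elements. It lies in the kernel of the trace, which is no
  larger.\<close>

lemma card_artin_schreier: "card {z :: 'a. z ^ 3 - z = v} = (if Tr m v = 0 then 3 else 0)"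
proof -
  let ?R = "range (\<lambda>z :: 'a. z ^ 3 - z)"
  have "{z :: 'a. z ^ 3 - z = v} = {}" if "v \<notin> ?R" for v using that by auto
  then have fiber: "card {z. z ^ 3 - z = v} = (if v \<in> ?R then 3 else 0)" for v
    using artin_schreier_fiber by auto
  have "int (3 ^ m) = (\<Sum>v\<in>UNIV. int (card {z :: 'a. z ^ 3 - z = v}))"
    using sum_fibers[of "\<lambda>_. 1" "\<lambda>z :: 'a. z ^ 3 - z"] card_UNIV by simp
  also have "\<dots> = (\<Sum>v\<in>UNIV. if v \<in> ?R then 3 else 0)"
    unfolding fiber by (intro sum.cong) auto
  also have "\<dots> = 3 * int (card ?R)" by (simp add: sum.If_cases)
  finally have "3 ^ m = 3 * card ?R" by linarith
  then have "card ?R = 3 ^ (m - 1)" using m by (cases m) auto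
  moreover have "?R \<subseteq> {x. Tr m x = 0}" using Tr_artin_schreier by auto
  ultimately have "?R = {x. Tr m x = 0}" using Tr_kernel_card by (intro card_seteq) auto
  then have "v \<in> ?R \<longleftrightarrow> Tr m v = 0" by blast
  then show ?thesis unfolding fiber by simp
qed

lemma F3val_simps: "F3val (0 :: 'a) = 0" "F3val (1 :: 'a) = 1" "F3val (- 1 :: 'a) = 2"
proof -
  have two: "(2 :: 'a) = -1"
  proof -
    have "(2 :: 'a) = 3 - 1" by simp
    then show ?thesis by (simp only: three)  simp
  qed
  have j: "j < 3 \<longleftrightarrow> j = 0 \<or> j = 1 \<or> j = 2" for j :: nat by auto
  show "F3val (0 :: 'a) = 0" "F3val (1 :: 'a) = 1" "F3val (- 1 :: 'a) = 2"
    unfolding F3val_def by (rule the_equality; use one_neq_minus_one in \<open>auto simp: j two\<close>)+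
qed

lemma cis_third_sum: "cis (2 * pi / 3) + cis (4 * pi / 3) = -1"
proof -
  have "cis (4 * pi / 3) = cis (2 * pi) * cis (- (2 * pi / 3))"
    unfolding cis_mult by (rule arg_cong[of _ _ cis]) simp
  also have "\<dots> = cis (- (2 * pi / 3))" by simp
  finally show ?thesis by (simp add: complex_eq_iff cos_120)
qed

text \<open>Both sides are 2 if the trace vanishes and -1 otherwise.\<close>

lemma cis_Tr_sum:
  "cis (2 * pi * real (F3val (Tr m (v :: 'a))) / 3) + cis (2 * pi * real (F3val (Tr m (- v))) / 3)
    = of_int (int (card {z :: 'a. z ^ 3 - z = v}) - 1)"
proof -
  have four: "2 * pi * 2 / 3 = 4 * pi / 3" by simp
  show ?thesis
    using Tr_cases[of v] cis_third_sum
    by (auto simp: Tr_minus card_artin_schreier F3val_simps four add.commute)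
qed

text \<open>Completing the square uses -1 = 2. The extra 1 at \<open>g = 0\<close> comes from
  \<open>x = 0\<close>, where \<open>a / 0 = 0\<close>.\<close>

lemma card_kloosterman_fiber:
  fixes a g :: 'a
  assumes a: "a \<noteq> 0"
  shows "int (card {x. g = x + a / x}) = (if g = 0 then 1 else 0) + 1 + chi (g\<^sup>2 - a)"
proof -
  have eq: "g = x + a / x \<longleftrightarrow> (x + g)\<^sup>2 = g\<^sup>2 - a" if "x \<noteq> 0" for x
  proof -
    have "g = x + a / x \<longleftrightarrow> x\<^sup>2 - g * x + a = 0" using that by (auto simp: field_simps power2_eq_square)
    also have "x\<^sup>2 - g * x + a = (x + g)\<^sup>2 - (g\<^sup>2 - a) + 3 * (- g * x)" by algebra
    finally show ?thesis by (simp add: three)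
  qed
  have "g = x + a / x \<longleftrightarrow> x \<in> (if g = 0 then {0} else {}) \<union> {x. (x + g)\<^sup>2 = g\<^sup>2 - a}" for x
    using eq[of x] a by (cases "x = 0") auto
  then have "{x. g = x + a / x} = (if g = 0 then {0} else {}) \<union> {x. (x + g)\<^sup>2 = g\<^sup>2 - a}" by blast
  moreover have "(if g = 0 then {0} else {}) \<inter> {x. (x + g)\<^sup>2 = g\<^sup>2 - a} = {}" using a by auto
  moreover have "card {x. (x + g)\<^sup>2 = g\<^sup>2 - a} = card {y. y\<^sup>2 = g\<^sup>2 - a}"
    by (rule bij_betw_same_card[of "\<lambda>x. x + g"], rule bij_betw_byWitness[where f' = "\<lambda>y. y - g"]) auto
  ultimately show ?thesis by (simp add: chi_def card_Un_disjoint)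
qed

text \<open>Pairing \<open>x\<close> with \<open>- x\<close> turns the sum into a count of the
  points of \<open>z ^ 3 - z = x + a / x\<close>, which is then taken over \<open>z\<close> instead
  of \<open>x\<close>. The 3 counts the roots of \<open>z ^ 3 = z\<close>.\<close>

lemma double_kloosterman:
  fixes a :: 'a
  assumes a: "a \<noteq> 0"
  shows "2 * K m a = of_int (3 + (\<Sum>z\<in>UNIV. chi ((z ^ 3 - z)\<^sup>2 - a)))"
proof -
  let ?e = "\<lambda>x :: 'a. cis (2 * pi * real (F3val (Tr m (x + a / x))) / 3)"
  have "K m a = (\<Sum>x\<in>UNIV. ?e (- x))"
    unfolding K_def by (rule sum.reindex_bij_witness[of _ uminus uminus]) auto
  then have "2 * K m a = (\<Sum>x\<in>UNIV. ?e x + ?e (- x))"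
    by (simp add: K_def sum.distrib)
  also have "\<dots> = (\<Sum>x\<in>UNIV. of_int (int (card {z. z ^ 3 - z = x + a / x}) - 1))"
  proof (rule sum.cong[OF refl])
    fix x
    have "- x + a / (- x) = - (x + a / x)" by simp
    then show "?e x + ?e (- x) = of_int (int (card {z. z ^ 3 - z = x + a / x}) - 1)"
      using cis_Tr_sum[of "x + a / x"] by simp
  qed
  also have "\<dots> = of_int ((\<Sum>x\<in>UNIV. int (card {z. z ^ 3 - z = x + a / x})) - 3 ^ m)"
    by (simp add: sum_subtractf card_UNIV)
  also have "(\<Sum>x\<in>UNIV. int (card {z. z ^ 3 - z = x + a / x}))
      = (\<Sum>z\<in>UNIV. (if z ^ 3 - z = 0 then 1 else 0) + 1 + chi ((z ^ 3 - z)\<^sup>2 - a))"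
    unfolding sum_card_swap card_kloosterman_fiber[OF a] ..
  also have "\<dots> = int (card {z :: 'a. z ^ 3 - z = 0}) + 3 ^ m + (\<Sum>z\<in>UNIV. chi ((z ^ 3 - z)\<^sup>2 - a))"
    by (simp add: sum.distrib sum.If_cases card_UNIV)
  also have "card {z :: 'a. z ^ 3 - z = 0} = 3" by (rule artin_schreier_fiber[of _ 0]) simp
  finally show ?thesis by simp
qed

lemma kloosterman_eq_card_pts:
  fixes a :: 'a
  assumes a: "a \<noteq> 0"
  shows "K m a = of_int (int (card (pts a)) - 3 ^ m)"
proof -
  have "2 * K m a = 2 * of_int (int (card (pts a)) - 3 ^ m)"
    unfolding double_kloosterman[OF a] sum_chi_cover[OF three a] card_pts[OF three]
    by (simp add: card_UNIV algebra_simps)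
  then show ?thesis by (subst (asm) mult_cancel_left) simp
qed

text \<open>A weak substitute for the Hasse bound: the trivial estimate on the double cover, where
  the character sum of the curve occurs twice.\<close>

lemma card_pts_le:
  fixes a :: 'a
  assumes a: "a \<noteq> 0"
  shows "2 * card (pts a) \<le> 3 * 3 ^ m + 3"
proof -
  have "(\<Sum>z\<in>UNIV. chi ((z ^ 3 - z)\<^sup>2 - a)) \<le> (\<Sum>z\<in>(UNIV :: 'a set). 1)"
    by (intro sum_mono chi_le_1)
  then have "int (2 * card (pts a)) \<le> int (3 * 3 ^ m + 3)"
    unfolding sum_chi_cover[OF three a] of_nat_mult card_pts[OF three] by (simp add: card_UNIV)
  then show ?thesis by (simp only: of_nat_le_iff)
qed

text \<open>The count is \<open>3 ^ m + n\<close> and lies strictly between 0 and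
  \<open>2 * 3 ^ m\<close>, so the absolute value of \<open>n\<close> is below \<open>3 ^ m\<close>.
  Up to exponent \<open>m\<close> the powers of 3 dividing \<open>n\<close> and the count agree;
  \<open>n = 0\<close> gives \<open>k = m\<close>, matching the convention.\<close>

lemma exact_3_power_kloosterman:
  fixes a :: 'a
  assumes m2: "m \<ge> 2" and a: "a \<noteq> 0"
    and k: "3 ^ k dvd card (pts a)" "\<not> 3 ^ (k + 1) dvd card (pts a)"
  shows "k \<le> m \<and> exact_3_power m k (K m a)"
proof -
  define n where "n = int (card (pts a)) - 3 ^ m"
  have card: "int (card (pts a)) = 3 ^ m + n" by (simp add: n_def)
  have pos: "card (pts a) > 0" by (auto simp: card_gt_0_iff pts_def)
  \<comment> \<open>From \<open>m \<ge> 2\<close> follows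
    \<open>3 * 3 ^ m + 3 < 4 * 3 ^ m\<close>.\<close>
  have "(3 :: nat) ^ 2 \<le> 3 ^ m" using m2 by (intro power_increasing) auto
  then have lt: "card (pts a) < 2 * 3 ^ m" using card_pts_le[OF a] by simp
  have "k \<le> m"
  proof (rule ccontr)
    assume "\<not> k \<le> m"
    then have "(3 :: nat) ^ Suc m \<le> 3 ^ k" by (intro power_increasing) auto
    then show False using dvd_imp_le[OF k(1) pos] lt by simp
  qed
  have dvd: "(3 :: int) ^ j dvd n \<longleftrightarrow> 3 ^ j dvd card (pts a)" if "j \<le> m" for j
  proof -
    have "(3 :: int) ^ j dvd 3 ^ m" using that by (rule le_imp_power_dvd)
    then have "(3 :: int) ^ j dvd n \<longleftrightarrow> (3 :: int) ^ j dvd int (card (pts a))"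
      unfolding card by (simp add: dvd_add_right_iff)
    also have "\<dots> \<longleftrightarrow> 3 ^ j dvd card (pts a)" by (metis int_dvd_int_iff of_nat_numeral of_nat_power)
    finally show ?thesis .
  qed
  have K: "K m a = of_int n" using kloosterman_eq_card_pts[OF a] by (simp add: n_def)
  have "exact_3_power m k (K m a)"
  proof (cases "n = 0")
    case True
    then have "card (pts a) = 3 ^ m" using card by (metis add.right_neutral of_nat_eq_iff of_nat_numeral of_nat_power)
    then have "\<not> k + 1 \<le> m" using k(2) by (auto simp: le_imp_power_dvd simp del: power_Suc)
    then show ?thesis using True K \<open>k \<le> m\<close> by (simp add: exact_3_power_def)
  next
    case False
    have "\<not> 3 ^ (k + 1) dvd n"
    proof (cases "k + 1 \<le> m")
      case False
      then have km: "k = m" using \<open>k \<le> m\<close> by simp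
      show ?thesis
      proof
        assume "3 ^ (k + 1) dvd n"
        then have "(3 :: int) ^ m dvd n" unfolding km by (metis dvd_mult_left power_add)
        then have "3 ^ m \<le> \<bar>n\<bar>" using \<open>n \<noteq> 0\<close> dvd_imp_le_int[of n "3 ^ m"] by simp
        moreover have "int (card (pts a)) < int (2 * 3 ^ m)" using lt by (simp only: of_nat_less_iff)
        then have "int (card (pts a)) < 2 * 3 ^ m" by simp
        moreover have "int (card (pts a)) > 0" using pos by simp
        ultimately show False unfolding card by linarith
      qed
    qed (use dvd k in blast)
    then show ?thesis using False K dvd[OF \<open>k \<le> m\<close>] k(1) by (auto simp: exact_3_power_def)
  qed
  then show ?thesis using \<open>k \<le> m\<close> by simp
qed

lemma cbrt_cube: "cbrt (a :: 'a) ^ 3 = a"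
proof -
  have "inj (\<lambda>x :: 'a. x ^ 3)" using cube_inj[OF three] by (auto simp: inj_def)
  then have "surj (\<lambda>x :: 'a. x ^ 3)" by (rule finite_UNIV_inj_surj[OF finite_class.finite_UNIV])
  then obtain c where c: "a = c ^ 3" by (meson surjD)
  show ?thesis unfolding cbrt_def
    by (rule theI[of _ c]) (use c cube_inj[OF three] in auto)
qed

text \<open>On the image of tripling the argument of the trace has the form
  \<open>z - z ^ 3\<close>, which has trace 0.\<close>

lemma not_thrice:
  fixes a u v :: 'a
  assumes a: "a \<noteq> 0" and tr: "Tr m (a * v / u ^ 3) \<noteq> 0"
  shows "Some (u, v) \<notin> thrice a ` pts a"
proof
  assume "Some (u, v) \<in> thrice a ` pts a"
  then obtain z where "a * v / u ^ 3 = - (z ^ 3 - z)"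
    using thrice_image[OF three a cbrt_cube, of u v] by auto
  then show False using tr Tr_minus[of "z ^ 3 - z"] Tr_artin_schreier[of z] by simp
qed

end

theorem theorem1:
  fixes a u1 y :: "'a::{finite,field}" and m :: nat and u :: "nat \<Rightarrow> 'a"
  assumes "m \<ge> 2"
    and "card (UNIV::'a set) = 3 ^ m"
    and "a \<noteq> 0"
    and "(u1, y) \<in> E a"
    and "Tr m (a * y / u1 ^ 3) \<noteq> 0"
    and "u 1 = u1"
    and "\<And>i. i \<ge> 1 \<Longrightarrow> u i \<noteq> cbrt a \<Longrightarrow>
           u (Suc i) = ((u i ^ 3 - a) ^ 3 + a * u i ^ 3) / (u i ^ 3 - a) ^ 2"
  shows "\<exists>k::nat. k \<le> m \<and>
     ((1 \<le> k \<and> u k = cbrt a \<and> (\<forall>i. 1 \<le> i \<and> i < k \<longrightarrow> u i \<noteq> cbrt a))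
      \<or> (\<exists>r::nat. r \<ge> 1 \<and> u (k + 1) = u (k + 1 + r)
           \<and> (\<forall>i. 1 \<le> i \<and> i < k + 1 + r \<longrightarrow> u i \<noteq> cbrt a)
           \<and> (\<forall>i j. 1 \<le> i \<and> i < j \<and> j < k + 1 + r \<longrightarrow> u i \<noteq> u j)))
     \<and> exact_3_power m k (K m a)"
proof -
  have m: "m \<ge> 1" using assms(1) by simp
  note card = assms(2)
  have "Some (u 1, y) \<in> pts a" using assms(4,6) by (simp add: E_def)
  moreover have "Some (u 1, y) \<notin> thrice a ` pts a"
    using not_thrice[OF m card assms(3)] assms(5,6) by simp
  ultimately show ?thesis
    using orbit_coordinates[OF three_eq_0[OF m card] assms(3) cbrt_cube[OF m card, of a], of u y]
      assms(7) exact_3_power_kloosterman[OF m card assms(1,3)] by blast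
qed

end
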